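(* Let $(\Omega,\mathcal{F},\mathsf{P})$ be a complete probability space, let $\mathsf{H}$ be a separable real Hilbert space, let $\mathsf{f}\in\Gamma_0(\mathsf{H})$ be such that $\operatorname{Argmin}\mathsf{f}\neq\varnothing$, let $(\gamma_n)_{n\in\mathbb{N}}$ be a decreasing sequence in $]0,+\infty[$ such that $\sum_{n\in\mathbb{N}}\gamma_n=+\infty$, let $(\mu_n)_{n\in\mathbb{N}}$ and $(\rho_n)_{n\in\mathbb{N}}$ be sequences of $[0,+\infty[$-valued random variables, and let $x_0\in L^2(\Omega,\mathcal{F},\mathsf{P};\mathsf{H})$. Let $(x_n)_{n\in\mathbb{N}}$ be a sequence in $L^2(\Omega,\mathcal{F},\mathsf{P};\mathsf{H})$ starting at $x_0$ such that, with $\mathcal{F}_n$ denoting the sub-$\sigma$-algebra of $\mathcal{F}$ generated by $(x_0,\ldots,x_n)$, $$(\forall n\in\mathbb{N})\quad x_{n+1}\underset{\mu_n,\rho_n}{\overset{\mathcal{F}_n}{\approx}}\operatorname{prox}_{\gamma_n\mathsf{f}}x_n,$$ and suppose that $\sum_{n\in\mathbb{N}}\mathsf{E}(\mu_n\mid\mathcal{F}_n)<+\infty$ $\mathsf{P}$-a.s. and $\sum_{n\in\mathbb{N}}\gamma_n^{-1}\mathsf{E}(\rho_n\mid\mathcal{F}_n)<+\infty$ $\mathsf{P}$-a.s. Then the following hold: (i) $(x_n)_{n\in\mathbb{N}}$ converges weakly $\mathsf{P}$-a.s. to an $(\operatorname{Argmin}\mathsf{f})$-valued random variable. (ii) Suppose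 that $\sum_{n\in\mathbb{N}}\mathsf{E}\mu_n<+\infty$ and $\sum_{n\in\mathbb{N}}\mathsf{E}\rho_n<+\infty$. Then $(x_n)_{n\in\mathbb{N}}$ converges weakly in $L^2(\Omega,\mathcal{F},\mathsf{P};\mathsf{H})$ to an $(\operatorname{Argmin}\mathsf{f})$-valued random variable. (iii) Set, for every $n\in\mathbb{N}$, $\theta_n=\sum_{k=0}^n\gamma_k$. Suppose that $\sum_{n\in\mathbb{N}}\theta_n\mathsf{E}(\mu_n\mid\mathcal{F}_n)<+\infty$ $\mathsf{P}$-a.s. and that $\sum_{n\in\mathbb{N}}\gamma_n^{-1}\theta_n\mathsf{E}(\rho_n\mid\mathcal{F}_n)<+\infty$ $\mathsf{P}$-a.s. Then $\mathsf{f}(x_n)-\inf\mathsf{f}(\mathsf{H})=\mathrm{o}(1/\theta_n)$ $\mathsf{P}$-a.s.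
   Context: $\Gamma_0(\mathsf{H})$ is the class of lower semicontinuous convex functions $\mathsf{f}\colon\mathsf{H}\to\,]-\infty,+\infty]$ that are not identically $+\infty$; $\operatorname{Argmin}\mathsf{f}$ is the set of minimizers of $\mathsf{f}$. For a sub-$\sigma$-algebra $\mathcal{A}$ of $\mathcal{F}$, $L^2(\Omega,\mathcal{A},\mathsf{P};\mathsf{H})$ is the space of (a.s. equivalence classes of) $\mathcal{A}$-measurable $\mathsf{H}$-valued random variables $x$ with $\mathsf{E}\|x\|^2<+\infty$. Definition (stochastic approximate proximity relation). Let $\mathsf{g}\in\Gamma_0(\mathsf{H})$, let $\mu$ and $\rho$ be $[0,+\infty[$-valued random variables, let $\mathcal{A}$ be a sub-$\sigma$-algebra of $\mathcal{F}$, let $x\in L^2(\Omega,\mathcal{A},\mathsf{P};\mathsf{H})$, and let $p\in L^2(\Omega,\mathcal{F},\mathsf{P};\mathsf{H})$. Then $p\underset{\mu,\rho}{\overset{\mathcal{A}}{\approx}}\operatorname{prox}_{\mathsf{g}}x$ means that, for every $y\in L^2(\Omega,\mathcal{A},\mathsf{P};\mathsf{H})$, $$\mathsf{E}\big(\langle y-p\mid x-p\rangle+\mathsf{g}(p)\,\big|\,\mathcal{A}\big)\leq\big(1+\mathsf{E}(\mu\mid\mathcal{A})\big)\mathsf{g}(y)+\mathsf{E}(\rho\mid\mathcal{A})\quad\mathsf{P}\text{-a.s.}$$ In the theorem this is used with $\mathsf{g}=\gamma_n\mathsf{f}$. "Decreasing" is understood in the wide sense ($\gamma_{n+1}\leq\gamma_n$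 for every $n$). "$u_n=\mathrm{o}(1/\theta_n)$ $\mathsf{P}$-a.s." means $\theta_nu_n\to0$ $\mathsf{P}$-a.s. as $n\to+\infty$. *)

theory Defs
  imports "HOL-Probability.Probability"
begin

text \<open>The class of proper lower semicontinuous convex functions with values in \<open>]-\<infinity>, +\<infinity>]\<close>.
  As the value \<open>-\<infinity>\<close> is excluded, the right-hand side of the convexity inequality
  never involves \<open>\<infinity> - \<infinity>\<close>.\<close>

definition Gamma0 :: "('h::real_normed_vector \<Rightarrow> ereal) set" where
  "Gamma0 = {f. (\<forall>h. f h \<noteq> -\<infinity>) \<and> (\<exists>h. f h \<noteq> \<infinity>) \<and>
     (\<forall>h. f h \<le> Liminf (nhds h) f) \<and>
     (\<forall>h k. \<forall>t\<in>{0<..<1::real}.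
        f (t *\<^sub>R h + (1 - t) *\<^sub>R k) \<le> ereal t * f h + ereal (1 - t) * f k)}"

definition Argmin :: "('h \<Rightarrow> ereal) \<Rightarrow> 'h set" where
  "Argmin f = {h. \<forall>k. f h \<le> f k}"

text \<open>Elements of \<open>L\<^sup>2\<close> are represented by functions rather than by classes modulo null sets.
  Measurability is with respect to \<open>A\<close>, integration with respect to \<open>M\<close>; only the
  \<open>\<sigma>\<close>-algebra of \<open>A\<close> matters, not its measure.\<close>

definition L2 :: "'w measure \<Rightarrow> 'w measure \<Rightarrow> ('w \<Rightarrow> 'h::real_normed_vector) set" where
  "L2 M A = {z \<in> borel_measurable A. integrable M (\<lambda>\<omega>. (norm (z \<omega>))\<^sup>2)}"

text \<open>Conditional expectation of an extended-real random variable, as the difference of those of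
  its positive and negative parts (\<^const>\<open>e2ennreal\<close> truncates negative values to \<open>0\<close>; compare
  \<^const>\<open>real_cond_exp\<close>). It is meaningful when the negative part is integrable: the
  subtrahend is then almost surely finite.\<close>

definition ereal_cond_exp :: "'w measure \<Rightarrow> 'w measure \<Rightarrow> ('w \<Rightarrow> ereal) \<Rightarrow> 'w \<Rightarrow> ereal" where
  "ereal_cond_exp M A X = (\<lambda>\<omega>.
     enn2ereal (nn_cond_exp M A (\<lambda>w. e2ennreal (X w)) \<omega>) -
     enn2ereal (nn_cond_exp M A (\<lambda>w. e2ennreal (- X w)) \<omega>))"

text \<open>The relation \<open>p \<approx> prox\<^sub>g x\<close> with error variables \<open>\<mu>, \<rho>\<close> relative to the
  sub-\<open>\<sigma>\<close>-algebra \<open>A\<close>. For \<open>g\<close> in \<^const>\<open>Gamma0\<close>, \<open>p\<close> in \<open>L2 M M\<close> and \<open>x, y\<close> in \<open>L2 M A\<close>, the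
  variable under the conditional expectation on the left has an integrable negative part, since
  \<open>g\<close> has a continuous affine minorant. The nonnegative variables \<open>\<mu>, \<rho>\<close> need not be integrable,
  so their conditional expectations are \<open>[0, +\<infinity>]\<close>-valued.\<close>

definition approx_prox ::
  "'w measure \<Rightarrow> 'w measure \<Rightarrow> ('w \<Rightarrow> real) \<Rightarrow> ('w \<Rightarrow> real) \<Rightarrow>
   ('h::real_inner \<Rightarrow> ereal) \<Rightarrow> ('w \<Rightarrow> 'h) \<Rightarrow> ('w \<Rightarrow> 'h) \<Rightarrow> bool" where
  "approx_prox M A \<mu> \<rho> g x p \<longleftrightarrow>
     (\<forall>y \<in> L2 M A. AE \<omega> in M.
        ereal_cond_exp M A (\<lambda>w. ereal ((y w - p w) \<bullet> (x w - p w)) + g (p w)) \<omega>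
        \<le> (1 + enn2ereal (nn_cond_exp M A (\<lambda>w. ennreal (\<mu> w)) \<omega>)) * g (y \<omega>)
          + enn2ereal (nn_cond_exp M A (\<lambda>w. ennreal (\<rho> w)) \<omega>))"

definition generated_algebra ::
  "'w measure \<Rightarrow> (nat \<Rightarrow> 'w \<Rightarrow> 'h::topological_space) \<Rightarrow> nat \<Rightarrow> 'w measure" where
  "generated_algebra M x n =
     sigma (space M) (\<Union>k\<in>{..n}. {x k -` B \<inter> space M | B. B \<in> sets borel})"

definition weakly_tendsto :: "(nat \<Rightarrow> 'h::real_inner) \<Rightarrow> 'h \<Rightarrow> bool" where
  "weakly_tendsto u l \<longleftrightarrow> (\<forall>h. (\<lambda>n. u n \<bullet> h) \<longlonglongrightarrow> l \<bullet> h)"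

definition weakly_tendsto_L2 ::
  "'w measure \<Rightarrow> (nat \<Rightarrow> 'w \<Rightarrow> 'h::real_inner) \<Rightarrow> ('w \<Rightarrow> 'h) \<Rightarrow> bool" where
  "weakly_tendsto_L2 M u l \<longleftrightarrow>
     (\<forall>z \<in> L2 M M. (\<lambda>n. \<integral>\<omega>. u n \<omega> \<bullet> z \<omega> \<partial>M) \<longlonglongrightarrow> (\<integral>\<omega>. l \<omega> \<bullet> z \<omega> \<partial>M))"

end

theory Submission
  imports Defs
begin

text \<open>Write \<open>a\<^sub>n\<close> for the excess \<open>f x\<^sub>n - min f\<close>. Testing the proximity relation at a minimizer \<open>z\<close> makes
  \<open>|x\<^sub>n - z|\<^sup>2\<close> an almost supermartingale and gives \<open>\<Sum> \<gamma>\<^sub>n E(a\<^sub>n\<^sub>+\<^sub>1 | F\<^sub>n) < \<infinity>\<close>; testing it at \<open>x\<^sub>n\<close> itself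
  makes \<open>a\<^sub>n\<close>, and then also \<open>\<theta>\<^sub>n a\<^sub>n\<close>, an almost supermartingale. By the Robbins--Siegmund theorem these
  processes converge almost surely, and \<open>\<Sum> \<gamma>\<^sub>n a\<^sub>n < \<infinity>\<close> together with the divergence of \<open>\<Sum> \<gamma>\<^sub>n\<close> and
  \<open>\<Sum> \<gamma>\<^sub>n / \<theta>\<^sub>n\<close> forces the limits of \<open>a\<^sub>n\<close> and \<open>\<theta>\<^sub>n a\<^sub>n\<close> to be \<open>0\<close>. Weak convergence follows pathwise from
  Opial's argument, applied on a countable dense set of minimizers, and passes to \<open>L\<^sup>2\<close> by Fatou's lemma
  because the iterates are bounded in \<open>L\<^sup>2\<close>.\<close>

text \<open>The error variables need not be integrable, \<open>f (x 0)\<close> may be infinite with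
  positive probability, and the minimum of \<open>f\<close> may be positive. Working in
  [0, \<infinity>] answers the first point: supermartingales are defined by integrals against
  nonnegative weights, so no expectation has to be finite. For the second, the excess is followed
  from index 1 on, where the Fejer estimate has already made it almost surely finite. For the third,
  subtracting the minimum m from \<open>f\<close> leaves a residue of size
  \<open>\<gamma> n * \<bar>m\<bar>\<close> times the conditional mean of \<open>\<mu> n\<close>,
  which is summable like the other errors. The passage from the excess to its multiple by
  \<open>\<theta> n\<close> rests on monotone step sizes: \<open>\<theta>\<close> grows by at most
  \<open>\<gamma> n\<close> from n to n + 1, and this growth costs exactly a term that the Fejer
  estimate has shown to be summable. A dense set of minimizers enters because the null set on which
  the distance to a minimizer fails to converge depends on the minimizer.\<close>

section \<open>Nonnegative supermartingales\<close>

lemma (in prob_space) sigma_finite_subalgebraI: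
  assumes "subalgebra M A" shows "sigma_finite_subalgebra M A"
proof -
  interpret finite_measure_subalgebra M A by unfold_locales (rule assms)
  show ?thesis by unfold_locales
qed

locale filtered_prob_space = prob_space M for M :: "'w measure" +
  fixes F :: "nat \<Rightarrow> 'w measure"
  assumes subalgebra_F: "subalgebra M (F n)"
    and sets_F_mono: "m \<le> n \<Longrightarrow> sets (F m) \<subseteq> sets (F n)"
begin

lemma space_F [simp]: "space (F n) = space M"
  using subalgebra_F by (simp add: subalgebra_def)

lemma measurable_F_mono: "g \<in> measurable (F m) N \<Longrightarrow> m \<le> n \<Longrightarrow> g \<in> measurable (F n) N"
  by (rule measurable_from_subalg[of "F n" "F m"]) (auto simp: subalgebra_def sets_F_mono)

lemma measurable_F_M: "g \<in> measurable (F n) N \<Longrightarrow> g \<in> measurable M N"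
  by (rule measurable_from_subalg[OF subalgebra_F])

lemma sigma_finite_subalgebra_F: "sigma_finite_subalgebra M (F n)"
  by (rule sigma_finite_subalgebraI[OF subalgebra_F])

text \<open>The weak form of \<open>E(Z (Suc n) | F n) \<le> Z n\<close>: arbitrary nonnegative
  weights known at time \<open>n\<close> replace the conditional expectation. The integrals may be
  infinite, and a factor measurable at time \<open>n\<close> can be absorbed into the
  weight.\<close>

definition supermartingale :: "(nat \<Rightarrow> 'w \<Rightarrow> ennreal) \<Rightarrow> bool" where
  "supermartingale Z \<longleftrightarrow> (\<forall>n. Z n \<in> borel_measurable (F n)) \<and>
     (\<forall>n. \<forall>\<phi>\<in>borel_measurable (F n).
        (\<integral>\<^sup>+\<omega>. \<phi> \<omega> * Z (Suc n) \<omega> \<partial>M) \<le> (\<integral>\<^sup>+\<omega>. \<phi> \<omega> * Z n \<omega> \<partial>M))"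

lemma supermartingaleD:
  assumes "supermartingale Z"
  shows "Z n \<in> borel_measurable (F n)"
    and "\<phi> \<in> borel_measurable (F n) \<Longrightarrow>
           (\<integral>\<^sup>+\<omega>. \<phi> \<omega> * Z (Suc n) \<omega> \<partial>M) \<le> (\<integral>\<^sup>+\<omega>. \<phi> \<omega> * Z n \<omega> \<partial>M)"
  using assms by (auto simp: supermartingale_def)

text \<open>The integrand is the process stopped at level \<open>c\<close>, with its value there lowered to \<open>c\<close>.\<close>

lemma supermartingale_stopped_integral_le:
  assumes Z: "supermartingale Z"
  shows "(\<integral>\<^sup>+\<omega>. (if \<exists>k\<le>n. c \<le> Z k \<omega> then c else Z n \<omega>) \<partial>M) \<le> (\<integral>\<^sup>+\<omega>. Z 0 \<omega> \<partial>M)"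
proof (induction n)
  case 0
  show ?case by (intro nn_integral_mono) auto
next
  case (Suc n)
  have ZF[measurable]: "Z k \<in> borel_measurable (F n)" if "k \<le> n" for k
    using supermartingaleD(1)[OF Z] that by (rule measurable_F_mono)
  have [measurable]: "Z k \<in> borel_measurable M" for k
    using supermartingaleD(1)[OF Z] by (rule measurable_F_M)
  have P: "Measurable.pred (F n) (\<lambda>\<omega>. \<exists>k\<le>n. c \<le> Z k \<omega>)"
    unfolding Bex_def[symmetric] atMost_iff[symmetric]
    by (rule pred_intros_finite) (auto intro!: borel_measurable_pred_less measurable_compose[OF ZF] )
  \<comment> \<open>\<open>\<phi>\<close> selects the paths still under \<open>c\<close> at time
    \<open>n\<close>. Those that reach \<open>c\<close> only at time \<open>Suc n\<close> have
    \<open>c \<le> Z (Suc n)\<close>, so lowering their value to \<open>c\<close> goes in the right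
    direction.\<close>
  define \<phi> :: "'w \<Rightarrow> ennreal" where "\<phi> = (\<lambda>\<omega>. if \<exists>k\<le>n. c \<le> Z k \<omega> then 0 else 1)"
  have \<phi>F[measurable]: "\<phi> \<in> borel_measurable (F n)" unfolding \<phi>_def using P by measurable
  have \<phi>M[measurable]: "\<phi> \<in> borel_measurable M" using \<phi>F by (rule measurable_F_M)
  have "(\<integral>\<^sup>+\<omega>. (if \<exists>k\<le>Suc n. c \<le> Z k \<omega> then c else Z (Suc n) \<omega>) \<partial>M)
     \<le> (\<integral>\<^sup>+\<omega>. c * (1 - \<phi> \<omega>) + \<phi> \<omega> * Z (Suc n) \<omega> \<partial>M)"
    by (intro nn_integral_mono) (auto simp: \<phi>_def le_Suc_eq)
  also have "\<dots> = (\<integral>\<^sup>+\<omega>. c * (1 - \<phi> \<omega>) \<partial>M) + (\<integral>\<^sup>+\<omega>. \<phi> \<omega> * Z (Suc n) \<omega> \<partial>M)"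
    by (rule nn_integral_add) measurable
  also have "\<dots> \<le> (\<integral>\<^sup>+\<omega>. c * (1 - \<phi> \<omega>) \<partial>M) + (\<integral>\<^sup>+\<omega>. \<phi> \<omega> * Z n \<omega> \<partial>M)"
    by (intro add_left_mono supermartingaleD(2)[OF Z] \<phi>F)
  also have "\<dots> = (\<integral>\<^sup>+\<omega>. c * (1 - \<phi> \<omega>) + \<phi> \<omega> * Z n \<omega> \<partial>M)"
    by (rule nn_integral_add[symmetric]) measurable
  also have "\<dots> = (\<integral>\<^sup>+\<omega>. (if \<exists>k\<le>n. c \<le> Z k \<omega> then c else Z n \<omega>) \<partial>M)"
    by (intro nn_integral_cong) (auto simp: \<phi>_def)
  finally show ?case using Suc by simp
qed

text \<open>Up to a finite horizon the stopped integrand is at least \<open>c\<close> on the event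
  that \<open>c\<close> has been reached; these events increase to the one over all times.\<close>

lemma supermartingale_maximal_inequality:
  assumes Z: "supermartingale Z"
  shows "c * emeasure M {\<omega>\<in>space M. \<exists>k. c \<le> Z k \<omega>} \<le> (\<integral>\<^sup>+\<omega>. Z 0 \<omega> \<partial>M)"
proof -
  have [measurable]: "Z k \<in> borel_measurable M" for k
    using supermartingaleD(1)[OF Z] by (rule measurable_F_M)
  define A where "A = (\<lambda>n. {\<omega>\<in>space M. \<exists>k\<le>n. c \<le> Z k \<omega>})"
  have A[measurable]: "A n \<in> sets M" for n unfolding A_def by measurable
  have "c * emeasure M (A n) \<le> (\<integral>\<^sup>+\<omega>. Z 0 \<omega> \<partial>M)" for n
  proof -
    have "c * emeasure M (A n) = (\<integral>\<^sup>+\<omega>. c * indicator (A n) \<omega> \<partial>M)"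
      by (simp add: nn_integral_cmult_indicator)
    also have "\<dots> \<le> (\<integral>\<^sup>+\<omega>. (if \<exists>k\<le>n. c \<le> Z k \<omega> then c else Z n \<omega>) \<partial>M)"
      by (intro nn_integral_mono) (auto simp: A_def indicator_def)
    finally show ?thesis using supermartingale_stopped_integral_le[OF Z, of n c] by simp
  qed
  then have "(SUP n. c * emeasure M (A n)) \<le> (\<integral>\<^sup>+\<omega>. Z 0 \<omega> \<partial>M)" by (rule SUP_least)
  also have "(SUP n. c * emeasure M (A n)) = c * emeasure M (\<Union>n. A n)"
    unfolding SUP_mult_left_ennreal[symmetric] using A
    by (subst SUP_emeasure_incseq) (auto simp: incseq_def A_def intro: order_trans)
  also have "(\<Union>n. A n) = {\<omega>\<in>space M. \<exists>k. c \<le> Z k \<omega>}" unfolding A_def by auto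
  finally show ?thesis .
qed

text \<open>The set of unbounded paths lies in every event of the maximal inequality, so all integer
  multiples of its measure stay below one finite number.\<close>

lemma supermartingale_AE_bounded:
  assumes Z: "supermartingale Z" and fin: "(\<integral>\<^sup>+\<omega>. Z 0 \<omega> \<partial>M) < \<infinity>"
  shows "AE \<omega> in M. \<exists>j::nat. \<forall>k. Z k \<omega> < of_nat j"
proof -
  have [measurable]: "Z k \<in> borel_measurable M" for k
    using supermartingaleD(1)[OF Z] by (rule measurable_F_M)
  define B where "B = {\<omega>\<in>space M. \<forall>j::nat. \<exists>k. of_nat j \<le> Z k \<omega>}"
  have [measurable]: "B \<in> sets M" unfolding B_def by measurable
  have "of_nat j * emeasure M B \<le> (\<integral>\<^sup>+\<omega>. Z 0 \<omega> \<partial>M)" for j :: nat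
  proof -
    have "of_nat j * emeasure M B \<le> of_nat j * emeasure M {\<omega>\<in>space M. \<exists>k. of_nat j \<le> Z k \<omega>}"
      by (intro mult_left_mono emeasure_mono) (auto simp: B_def)
    then show ?thesis using supermartingale_maximal_inequality[OF Z] by (rule order_trans)
  qed
  then have "(SUP j::nat. of_nat j * emeasure M B) \<le> (\<integral>\<^sup>+\<omega>. Z 0 \<omega> \<partial>M)" by (rule SUP_least)
  then have "\<infinity> * emeasure M B < \<infinity>"
    using fin by (simp add: SUP_mult_right_ennreal[symmetric] ennreal_SUP_of_nat_eq_top)
  then have "emeasure M B = 0" by (auto simp: ennreal_top_mult split: if_splits)
  then have "AE \<omega> in M. \<omega> \<notin> B" by (intro AE_not_in) auto
  then show ?thesis by (rule AE_mp) (rule AE_I2, auto simp: B_def not_le)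
qed

end

text \<open>Upcrossings of \<open>[a, b]\<close>: \<open>below v n\<close> means that \<open>v\<close> has been at or below \<open>a\<close> since it was last at or
  above \<open>b\<close>, and \<open>upcrossings v n\<close> counts the completed crossings up to time \<open>n\<close>.\<close>

context
  fixes a b :: ennreal
begin

primrec below :: "(nat \<Rightarrow> ennreal) \<Rightarrow> nat \<Rightarrow> bool" where
  "below v 0 \<longleftrightarrow> v 0 \<le> a"
| "below v (Suc n) \<longleftrightarrow> (if below v n then v (Suc n) < b else v (Suc n) \<le> a)"

primrec upcrossings :: "(nat \<Rightarrow> ennreal) \<Rightarrow> nat \<Rightarrow> nat" where
  "upcrossings v 0 = 0"
| "upcrossings v (Suc n) = upcrossings v n + (if below v n \<and> b \<le> v (Suc n) then 1 else 0)"

text \<open>After a completed crossing, a later value under \<open>a\<close> opens a new one and the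
  next value at or above \<open>b\<close> closes it. The conjunct \<open>\<not> below v n\<close>
  carries the induction and makes \<open>dubins\<close> a pure power of \<open>b / a\<close> at that
  time.\<close>

lemma upcrossings_unbounded:
  assumes "a < b" and low: "\<exists>\<^sub>F n in sequentially. v n < a" and high: "\<exists>\<^sub>F n in sequentially. b < v n"
  shows "\<exists>n. \<not> below v n \<and> k \<le> upcrossings v n"
proof (induction k)
  case 0
  obtain n where n: "b < v n" using high by (auto simp: frequently_sequentially)
  have "\<not> below v n" using n \<open>a < b\<close> by (cases n) (auto simp: not_le intro: less_trans)
  then show ?case by auto
next
  case (Suc k)
  then obtain n where n: "\<not> below v n" "k \<le> upcrossings v n" by auto
  obtain p where p: "n < p" "v p < a"
    using low unfolding frequently_sequentially by (meson Suc_le_lessD)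
  have mono: "i \<le> j \<Longrightarrow> upcrossings v i \<le> upcrossings v j" for i j
    by (rule lift_Suc_mono_le[of "upcrossings v"]) auto
  have bp: "below v p" using p \<open>a < b\<close> by (cases p) auto
  obtain q0 where q0: "p < q0" "b < v q0"
    using high unfolding frequently_sequentially by (meson Suc_le_lessD)
  \<comment> \<open>Taking the least such index keeps all values strictly between \<open>p\<close>
    and \<open>q\<close> under \<open>b\<close>, so that the open crossing persists until just
    before \<open>q\<close>.\<close>
  define q where "q = (LEAST q. p < q \<and> b \<le> v q)"
  have q: "p < q" "b \<le> v q" using LeastI[of "\<lambda>q. p < q \<and> b \<le> v q" q0] q0 by (auto simp: q_def)
  have qmin: "v r < b" if "p < r" "r < q" for r
    using not_less_Least[of r "\<lambda>q. p < q \<and> b \<le> v q"] that by (auto simp: q_def not_le)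
  have in_r: "r < q \<Longrightarrow> below v r" if "p \<le> r" for r
    using that
  proof (induction r rule: dec_induct)
    case base show ?case by (rule bp)
  next
    case (step r) then show ?case using qmin[of "Suc r"] by auto
  qed
  obtain r where r: "q = Suc r" "p \<le> r" using q by (cases q) auto
  have "below v r" using in_r[of r] r by auto
  then have "\<not> below v q" "upcrossings v q = Suc (upcrossings v r)" using q r by auto
  moreover have "k \<le> upcrossings v r" using n(2) mono[of n r] p r by auto
  ultimately show ?case by (intro exI[of _ q]) auto
qed

text \<open>Dubins' device: a supermartingale transform that starts below \<open>1\<close> and gains a factor \<open>b / a\<close> with
  every completed upcrossing, so that the maximal inequality excludes infinitely many upcrossings.\<close>

definition dubins :: "(nat \<Rightarrow> ennreal) \<Rightarrow> nat \<Rightarrow> ennreal" where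
  "dubins v n = (b / a) ^ upcrossings v n * (if below v n then v n / a else 1)"

text \<open>The bound is affine in \<open>v (Suc n)\<close> with coefficients known at time
  \<open>n\<close>, which is the form to which a supermartingale inequality applies. Closing a
  crossing gains \<open>b / a\<close>, at most \<open>v (Suc n) / a\<close>; opening one replaces 1
  by \<open>v (Suc n) / a\<close>, which is at most 1.\<close>

lemma dubins_Suc_le:
  assumes "0 < a" "a < \<infinity>"
  shows "dubins v (Suc n) \<le> (b / a) ^ upcrossings v n * (if below v n then v (Suc n) / a else 1)"
proof -
  have "b / a \<le> v (Suc n) / a" if "b \<le> v (Suc n)"
    using that by (rule divide_right_mono_ennreal)
  moreover have "v (Suc n) / a \<le> 1" if "v (Suc n) \<le> a"
    using that assms by (metis divide_right_mono_ennreal ennreal_divide_self infinity_ennreal_def not_gr_zero)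
  ultimately show ?thesis
    by (auto simp: dubins_def not_less mult.commute[of "b / a"] mult_left_mono intro!: mult_left_le)
qed

end

context filtered_prob_space
begin

lemma below_measurable:
  assumes V: "\<And>n. V n \<in> borel_measurable (F n)" and "n \<le> m"
  shows "Measurable.pred (F m) (\<lambda>\<omega>. below a b (\<lambda>k. V k \<omega>) n)"
  using \<open>n \<le> m\<close>
proof (induction n)
  case 0
  have [measurable]: "V 0 \<in> borel_measurable (F m)" using V measurable_F_mono by blast
  show ?case by simp
next
  case (Suc n)
  have [measurable]: "V (Suc n) \<in> borel_measurable (F m)" using V measurable_F_mono Suc by blast
  have [measurable]: "Measurable.pred (F m) (\<lambda>\<omega>. below a b (\<lambda>k. V k \<omega>) n)" using Suc by auto
  show ?case by simp
qed

lemma upcrossings_measurable: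
  assumes V: "\<And>n. V n \<in> borel_measurable (F n)" and "n \<le> m"
  shows "(\<lambda>\<omega>. upcrossings a b (\<lambda>k. V k \<omega>) n) \<in> measurable (F m) (count_space UNIV)"
  using \<open>n \<le> m\<close>
proof (induction n)
  case 0
  show ?case by simp
next
  case (Suc n)
  have [measurable]: "V (Suc n) \<in> borel_measurable (F m)" using V measurable_F_mono Suc by blast
  have [measurable]: "Measurable.pred (F m) (\<lambda>\<omega>. below a b (\<lambda>k. V k \<omega>) n)"
    using below_measurable[OF V] Suc by auto
  have [measurable]: "(\<lambda>\<omega>. upcrossings a b (\<lambda>k. V k \<omega>) n) \<in> measurable (F m) (count_space UNIV)"
    using Suc by auto
  show ?case by simp
qed

lemma dubins_supermartingale:
  assumes V: "supermartingale V" and a: "0 < a" "a < \<infinity>"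
  shows "supermartingale (\<lambda>n \<omega>. dubins a b (\<lambda>k. V k \<omega>) n)"
proof -
  note VF[measurable] = supermartingaleD(1)[OF V]
  note [measurable] = below_measurable[OF VF order_refl] upcrossings_measurable[OF VF order_refl]
  have meas: "(\<lambda>\<omega>. dubins a b (\<lambda>k. V k \<omega>) n) \<in> borel_measurable (F n)" for n
    unfolding dubins_def by measurable
  moreover have "(\<integral>\<^sup>+\<omega>. \<phi> \<omega> * dubins a b (\<lambda>k. V k \<omega>) (Suc n) \<partial>M)
      \<le> (\<integral>\<^sup>+\<omega>. \<phi> \<omega> * dubins a b (\<lambda>k. V k \<omega>) n \<partial>M)" if \<phi>[measurable]: "\<phi> \<in> borel_measurable (F n)" for n \<phi>
  proof -
    define c where "c = (\<lambda>\<omega>. (b / a) ^ upcrossings a b (\<lambda>k. V k \<omega>) n)"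
    define \<psi> where "\<psi> = (\<lambda>\<omega>. \<phi> \<omega> * c \<omega> * (if below a b (\<lambda>k. V k \<omega>) n then 1 / a else 0))"
    define \<eta> where "\<eta> = (\<lambda>\<omega>. \<phi> \<omega> * c \<omega> * (if below a b (\<lambda>k. V k \<omega>) n then 0 else 1))"
    have \<psi>F: "\<psi> \<in> borel_measurable (F n)" and "\<eta> \<in> borel_measurable (F n)"
      unfolding \<psi>_def \<eta>_def c_def by measurable
    then have [measurable]: "\<psi> \<in> borel_measurable M" "\<eta> \<in> borel_measurable M"
      using measurable_F_M by auto
    have [measurable]: "V k \<in> borel_measurable M" for k using VF by (rule measurable_F_M)
    have "(\<integral>\<^sup>+\<omega>. \<phi> \<omega> * dubins a b (\<lambda>k. V k \<omega>) (Suc n) \<partial>M) \<le> (\<integral>\<^sup>+\<omega>. \<psi> \<omega> * V (Suc n) \<omega> + \<eta> \<omega> \<partial>M)"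
    proof (rule nn_integral_mono)
      fix \<omega>
      have "\<phi> \<omega> * dubins a b (\<lambda>k. V k \<omega>) (Suc n)
        \<le> \<phi> \<omega> * (c \<omega> * (if below a b (\<lambda>k. V k \<omega>) n then V (Suc n) \<omega> / a else 1))"
        unfolding c_def by (intro mult_left_mono dubins_Suc_le[OF a]) auto
      also have "\<dots> = \<psi> \<omega> * V (Suc n) \<omega> + \<eta> \<omega>"
        by (simp add: \<psi>_def \<eta>_def divide_ennreal_def mult_ac)
      finally show "\<phi> \<omega> * dubins a b (\<lambda>k. V k \<omega>) (Suc n) \<le> \<psi> \<omega> * V (Suc n) \<omega> + \<eta> \<omega>" .
    qed
    also have "\<dots> = (\<integral>\<^sup>+\<omega>. \<psi> \<omega> * V (Suc n) \<omega> \<partial>M) + (\<integral>\<^sup>+\<omega>. \<eta> \<omega> \<partial>M)"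
      by (rule nn_integral_add) measurable
    also have "\<dots> \<le> (\<integral>\<^sup>+\<omega>. \<psi> \<omega> * V n \<omega> \<partial>M) + (\<integral>\<^sup>+\<omega>. \<eta> \<omega> \<partial>M)"
      by (intro add_right_mono supermartingaleD(2)[OF V] \<psi>F)
    also have "\<dots> = (\<integral>\<^sup>+\<omega>. \<psi> \<omega> * V n \<omega> + \<eta> \<omega> \<partial>M)"
      by (rule nn_integral_add[symmetric]) measurable
    \<comment> \<open>With \<open>V n\<close> in place of \<open>V (Suc n)\<close> the affine bound
      is the transform itself at time \<open>n\<close>.\<close>
    also have "\<dots> = (\<integral>\<^sup>+\<omega>. \<phi> \<omega> * dubins a b (\<lambda>k. V k \<omega>) n \<partial>M)"
      by (intro nn_integral_cong)
         (simp add: \<psi>_def \<eta>_def c_def dubins_def divide_ennreal_def mult_ac)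
    finally show ?thesis .
  qed
  ultimately show ?thesis by (auto simp: supermartingale_def)
qed

text \<open>The transform starts at or below 1 whatever \<open>V 0\<close> is, so it is almost
  surely bounded, whereas an oscillating path would drive it through all powers of
  \<open>b / a\<close>.\<close>

lemma supermartingale_no_oscillation:
  assumes V: "supermartingale V" and a: "0 < a" "a < b" "b < \<infinity>"
  shows "AE \<omega> in M. \<not> ((\<exists>\<^sub>F n in sequentially. V n \<omega> < a) \<and> (\<exists>\<^sub>F n in sequentially. b < V n \<omega>))"
proof -
  have a': "a < \<infinity>" using a by auto
  have "(\<integral>\<^sup>+\<omega>. dubins a b (\<lambda>k. V k \<omega>) 0 \<partial>M) \<le> (\<integral>\<^sup>+\<omega>. 1 \<partial>M)"
    using a a' by (intro nn_integral_mono)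
      (auto simp: dubins_def, metis divide_right_mono_ennreal ennreal_divide_self infinity_ennreal_def not_gr_zero)
  also have "\<dots> < \<infinity>" by (simp add: emeasure_space_1)
  finally have "AE \<omega> in M. \<exists>j::nat. \<forall>k. dubins a b (\<lambda>k. V k \<omega>) k < of_nat j"
    by (rule supermartingale_AE_bounded[OF dubins_supermartingale[OF V a(1) a']])
  then show ?thesis
  proof (rule AE_mp, intro AE_I2 impI notI)
    fix \<omega>
    assume "\<exists>j::nat. \<forall>k. dubins a b (\<lambda>k. V k \<omega>) k < of_nat j"
    then obtain j :: nat where j: "\<And>k. dubins a b (\<lambda>k. V k \<omega>) k < of_nat j" by auto
    assume osc: "(\<exists>\<^sub>F n in sequentially. V n \<omega> < a) \<and> (\<exists>\<^sub>F n in sequentially. b < V n \<omega>)"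
    obtain x where x: "a = ennreal x" "0 < x" using a a' by (cases a) auto
    obtain y where y: "b = ennreal y" "0 < y" "x < y" using a x by (cases b) (auto simp: ennreal_less_iff)
    have ba: "b / a = ennreal (y / x)" using x y by (simp add: divide_ennreal)
    obtain k where k: "real j < (y / x) ^ k" using real_arch_pow[of "y / x" j] x y by auto
    obtain n where n: "\<not> below a b (\<lambda>k. V k \<omega>) n" "k \<le> upcrossings a b (\<lambda>k. V k \<omega>) n"
      using upcrossings_unbounded[OF a(2), of "\<lambda>k. V k \<omega>" k] osc by blast
    have "of_nat j \<le> ennreal ((y / x) ^ k)" using k by (simp add: ennreal_of_nat_eq_real_of_nat)
    also have "\<dots> \<le> ennreal ((y / x) ^ upcrossings a b (\<lambda>k. V k \<omega>) n)"
      using x y n by (intro ennreal_leI power_increasing) auto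
    also have "\<dots> = dubins a b (\<lambda>k. V k \<omega>) n"
      using n(1) x y unfolding dubins_def ba by (simp add: ennreal_power)
    finally show False using j[of n] by simp
  qed
qed

text \<open>If liminf and limsup differed, two rationals between them would be crossed infinitely
  often. The limit may be \<open>\<infinity>\<close>, as nothing is assumed about the size of
  \<open>V 0\<close>.\<close>

lemma supermartingale_AE_convergent:
  assumes V: "supermartingale V"
  shows "AE \<omega> in M. \<exists>l. (\<lambda>n. V n \<omega>) \<longlonglongrightarrow> l"
proof -
  have "AE \<omega> in M. \<forall>p q::rat. 0 < p \<and> p < q \<longrightarrow>
      \<not> ((\<exists>\<^sub>F n in sequentially. V n \<omega> < ennreal (of_rat p)) \<and>
         (\<exists>\<^sub>F n in sequentially. ennreal (of_rat q) < V n \<omega>))"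
    by (simp only: AE_all_countable AE_conj_iff, intro allI AE_impI supermartingale_no_oscillation[OF V])
       (auto simp: ennreal_less_iff of_rat_less)
  then show ?thesis
  proof (rule AE_mp, intro AE_I2 impI)
    fix \<omega>
    assume no: "\<forall>p q::rat. 0 < p \<and> p < q \<longrightarrow>
      \<not> ((\<exists>\<^sub>F n in sequentially. V n \<omega> < ennreal (of_rat p)) \<and>
         (\<exists>\<^sub>F n in sequentially. ennreal (of_rat q) < V n \<omega>))"
    let ?v = "\<lambda>n. V n \<omega>"
    have "limsup ?v \<le> liminf ?v"
    proof (rule ccontr)
      assume "\<not> limsup ?v \<le> liminf ?v"
      then have less: "liminf ?v < limsup ?v" by simp
      obtain p :: rat where p: "liminf ?v < ennreal (of_rat p)" "ennreal (of_rat p) < limsup ?v"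
        using ennreal_rat_dense[OF less] by auto
      obtain q :: rat where q: "ennreal (of_rat p) < ennreal (of_rat q)" "ennreal (of_rat q) < limsup ?v"
        using ennreal_rat_dense[OF p(2)] by auto
      \<comment> \<open>\<open>ennreal\<close> sends nonpositive rationals to 0, and nothing in
        [0, \<infinity>] lies under 0.\<close>
      have p0: "0 < p" using p(1) by (metis ennreal_neg le_less_trans not_less not_less_zero of_rat_le_0_iff)
      have pq: "p < q" using q(1) p0 by (metis ennreal_leI not_less of_rat_less_eq)
      have "\<exists>\<^sub>F n in sequentially. ?v n < ennreal (of_rat p)"
      proof (rule ccontr)
        assume "\<not> ?thesis"
        then have "\<forall>\<^sub>F n in sequentially. ennreal (of_rat p) \<le> ?v n"
          by (simp add: frequently_def not_less)
        from Liminf_bounded[OF this] p(1) show False by simp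
      qed
      moreover have "\<exists>\<^sub>F n in sequentially. ennreal (of_rat q) < ?v n"
      proof (rule ccontr)
        assume "\<not> ?thesis"
        then have "\<forall>\<^sub>F n in sequentially. ?v n \<le> ennreal (of_rat q)"
          by (simp add: frequently_def not_less)
        from Limsup_bounded[OF this] q(2) show False by simp
      qed
      ultimately show False using no p0 pq by blast
    qed
    then have "limsup ?v = liminf ?v" by (intro antisym Liminf_le_Limsup) auto
    then show "\<exists>l. ?v \<longlonglongrightarrow> l" using tendsto_iff_Liminf_eq_Limsup[of sequentially ?v] by auto
  qed
qed

end

section \<open>The Robbins--Siegmund theorem\<close>

text \<open>Since 1 + t is at most exp t, the increasing partial products are bounded by the
  exponential of the sum.\<close>

lemma prod_one_plus_bounded:
  fixes \<alpha> :: "nat \<Rightarrow> ennreal"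
  assumes "(\<Sum>n. \<alpha> n) < \<infinity>"
  obtains p where "(\<lambda>n. \<Prod>k<n. 1 + \<alpha> k) \<longlonglongrightarrow> p" "p < \<infinity>" "\<And>n. (\<Prod>k<n. 1 + \<alpha> k) \<le> p"
proof -
  let ?P = "\<lambda>n. \<Prod>k<n. 1 + \<alpha> k"
  have fin: "\<alpha> n < top" for n using assms ennreal_suminf_lessD by fastforce
  have inc: "incseq ?P"
  proof (rule incseq_SucI)
    fix n
    have "?P n * 1 \<le> ?P n * (1 + \<alpha> n)" by (rule mult_left_mono) auto
    then show "?P n \<le> ?P (Suc n)" by simp
  qed
  have le: "?P n \<le> ennreal (exp (\<Sum>k<n. enn2real (\<alpha> k)))" for n
  proof (induction n)
    case (Suc n)
    have "1 + \<alpha> n = ennreal (1 + enn2real (\<alpha> n))"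
      using fin[of n] by (cases "\<alpha> n") auto
    also have "\<dots> \<le> ennreal (exp (enn2real (\<alpha> n)))" by (intro ennreal_leI exp_ge_add_one_self)
    finally have "?P n * (1 + \<alpha> n) \<le> ennreal (exp (\<Sum>k<n. enn2real (\<alpha> k))) * ennreal (exp (enn2real (\<alpha> n)))"
      by (intro mult_mono Suc) auto
    then show ?case by (simp add: exp_add ennreal_mult[symmetric])
  qed simp
  have "(\<Sum>k<n. enn2real (\<alpha> k)) \<le> enn2real (\<Sum>n. \<alpha> n)" for n
  proof -
    have "(\<Sum>k<n. enn2real (\<alpha> k)) = enn2real (\<Sum>k<n. \<alpha> k)" using fin by (simp add: enn2real_sum)
    also have "\<dots> \<le> enn2real (\<Sum>n. \<alpha> n)" using assms by (intro enn2real_mono sum_le_suminf) auto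
    finally show ?thesis .
  qed
  then have "?P n \<le> ennreal (exp (enn2real (\<Sum>n. \<alpha> n)))" for n
    by (intro order_trans[OF le] ennreal_leI) simp
  then have "(SUP n. ?P n) \<le> ennreal (exp (enn2real (\<Sum>n. \<alpha> n)))" by (rule SUP_least)
  then have "(SUP n. ?P n) < \<infinity>" by (auto intro: le_less_trans)
  then show thesis by (rule that[OF LIMSEQ_SUP[OF inc] _ SUP_upper]) auto
qed

text \<open>The compensated process \<open>V n / P n + \<Sum>U / P + (K - \<Sum>\<beta> / P)\<close>, with \<open>P\<close> the product of the factors
  \<open>1 + \<alpha>\<close>, killed when the accumulated errors exceed \<open>K\<close>; the killing keeps it nonnegative.\<close>

definition rs_comp ::
  "(nat \<Rightarrow> ennreal) \<Rightarrow> (nat \<Rightarrow> ennreal) \<Rightarrow> (nat \<Rightarrow> ennreal) \<Rightarrow> ennreal \<Rightarrow> (nat \<Rightarrow> ennreal) \<Rightarrow> nat \<Rightarrow> ennreal" where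
  "rs_comp \<alpha> \<beta> U K V n =
    (if (\<Sum>k<n. \<beta> k / (\<Prod>i<Suc k. 1 + \<alpha> i)) \<le> K
     then V n / (\<Prod>i<n. 1 + \<alpha> i) + (\<Sum>k<n. U k / (\<Prod>i<Suc k. 1 + \<alpha> i))
        + (K - (\<Sum>k<n. \<beta> k / (\<Prod>i<Suc k. 1 + \<alpha> i))) else 0)"

text \<open>Once \<open>K\<close> exceeds the total error of the path, no killing occurs. The two
  accumulated sums are then monotone and bounded, so they can be subtracted from the limit in
  [0, \<infinity>]; multiplying by the convergent product recovers \<open>V\<close>.\<close>

lemma rs_comp_converges_imp:
  assumes \<alpha>: "(\<Sum>n. \<alpha> n) < \<infinity>" and \<beta>: "(\<Sum>n. \<beta> n) < \<infinity>"
    and conv: "\<And>K::nat. \<exists>l<\<infinity>. rs_comp \<alpha> \<beta> U (of_nat K) V \<longlonglongrightarrow> l"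
  shows "(\<Sum>n. U n) < \<infinity> \<and> (\<exists>l<\<infinity>. V \<longlonglongrightarrow> l)"
proof -
  define P where "P = (\<lambda>n. \<Prod>i<n. 1 + \<alpha> i)"
  define B where "B = (\<lambda>n. \<Sum>k<n. \<beta> k / P (Suc k))"
  define S where "S = (\<lambda>n. \<Sum>k<n. U k / P (Suc k))"
  obtain p where p: "P \<longlonglongrightarrow> p" "p < \<infinity>" "\<And>n. P n \<le> p"
    unfolding P_def by (rule prod_one_plus_bounded[OF \<alpha>]) blast
  have P1: "1 \<le> P n" for n unfolding P_def by (rule prod_ge_1) auto
  have P0: "P n \<noteq> 0" "P n < top" for n
    using P1[of n] p(2) p(3)[of n] by (auto intro: le_less_trans)
  have B_le: "B n \<le> (\<Sum>n. \<beta> n)" for n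
  proof -
    have "\<beta> k / P (Suc k) \<le> \<beta> k" for k
      using mult_right_mono[OF P1[of "Suc k"], of "\<beta> k"] P0 by (intro divide_le_posI_ennreal) (auto simp: zero_less_iff_neq_zero)
    then have "B n \<le> (\<Sum>k<n. \<beta> k)" unfolding B_def by (rule sum_mono)
    also have "\<dots> \<le> (\<Sum>n. \<beta> n)" by (intro sum_le_suminf) auto
    finally show ?thesis .
  qed
  \<comment> \<open>\<open>K\<close> depends on the path, which is why convergence is assumed for
    every natural number.\<close>
  obtain K :: nat where K: "(\<Sum>n. \<beta> n) < of_nat K" using ennreal_Ex_less_of_nat \<beta> by auto
  obtain l where l: "l < \<infinity>" "rs_comp \<alpha> \<beta> U (of_nat K) V \<longlonglongrightarrow> l" using conv by auto
  have Z: "rs_comp \<alpha> \<beta> U (of_nat K) V n = V n / P n + S n + (of_nat K - B n)" for n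
  proof -
    have "rs_comp \<alpha> \<beta> U (of_nat K) V n = (if B n \<le> of_nat K then V n / P n + S n + (of_nat K - B n) else 0)"
      unfolding rs_comp_def B_def S_def P_def ..
    then show ?thesis using order_trans[OF B_le[of n] less_imp_le[OF K]] by simp
  qed
  have incS: "incseq S" and incB: "incseq B" unfolding S_def B_def by (auto intro!: incseq_SucI)
  have "l < l + 1" using l by (cases l) (auto simp: ennreal_less_iff ennreal_plus[symmetric] ennreal_1[symmetric] simp del: ennreal_plus ennreal_1)
  then have "\<forall>\<^sub>F n in sequentially. rs_comp \<alpha> \<beta> U (of_nat K) V n < l + 1" using l(2) order_tendstoD(2) by blast
  then obtain N where N: "\<And>n. n \<ge> N \<Longrightarrow> rs_comp \<alpha> \<beta> U (of_nat K) V n < l + 1" by (auto simp: eventually_sequentially)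
  have S_le: "S n \<le> l + 1" for n
  proof -
    have "S n \<le> S (max n N)" using incS by (auto simp: incseq_def)
    also have "\<dots> \<le> rs_comp \<alpha> \<beta> U (of_nat K) V (max n N)" unfolding Z by (simp add: add_increasing add_increasing2)
    also have "\<dots> \<le> l + 1" using N[of "max n N"] by auto
    finally show ?thesis .
  qed
  have "(SUP n. S n) < \<infinity>" using SUP_least[of UNIV S, OF S_le] l(1) by (auto intro: le_less_trans)
  then obtain s where S: "S \<longlonglongrightarrow> s" and Sfin: "s \<noteq> top" using LIMSEQ_SUP[OF incS] by (metis infinity_ennreal_def less_irrefl)
  have "(SUP n. B n) < \<infinity>" using SUP_least[of UNIV B, OF B_le] \<beta> by (auto intro: le_less_trans)
  then obtain b where B: "B \<longlonglongrightarrow> b" and Bfin: "b \<noteq> top" using LIMSEQ_SUP[OF incB] by (metis infinity_ennreal_def less_irrefl)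
  have "(\<lambda>n. S n + (of_nat K - B n)) \<longlonglongrightarrow> s + (of_nat K - b)"
    by (intro tendsto_add tendsto_diff_ennreal S B tendsto_const ennreal_of_nat_neq_top Bfin)
  then have "(\<lambda>n. rs_comp \<alpha> \<beta> U (of_nat K) V n - (S n + (of_nat K - B n)))
      \<longlonglongrightarrow> l - (s + (of_nat K - b))"
    using Sfin Bfin l by (intro tendsto_diff_ennreal) (auto simp: top_unique)
  moreover have "rs_comp \<alpha> \<beta> U (of_nat K) V n - (S n + (of_nat K - B n)) = V n / P n" for n
  proof -
    have "S n + (of_nat K - B n) \<noteq> top"
      using S_le[of n] l by (auto simp: top_unique)
    then show ?thesis unfolding Z add.assoc by simp
  qed
  ultimately have "(\<lambda>n. V n / P n) \<longlonglongrightarrow> l - (s + (of_nat K - b))" by simp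
  then obtain m where m: "(\<lambda>n. V n / P n) \<longlonglongrightarrow> m" "m < \<infinity>"
    using l(1) by (metis diff_less_top_ennreal infinity_ennreal_def)
  have "(\<lambda>n. V n / P n * P n) \<longlonglongrightarrow> m * p"
    using m p by (intro tendsto_mult_ennreal) auto
  then have "V \<longlonglongrightarrow> m * p" using P0 by (simp add: ennreal_divide_times)
  moreover have "m * p < \<infinity>" using m p by (simp add: ennreal_mult_less_top)
  moreover have "(\<Sum>n. U n) < \<infinity>"
  proof -
    have "(\<Sum>n. U n) = (\<Sum>n. U n / P (Suc n) * P (Suc n))" using P0 by (simp add: ennreal_divide_times)
    also have "\<dots> \<le> (\<Sum>n. U n / P (Suc n) * p)" by (intro suminf_le mult_left_mono p) auto
    also have "\<dots> = s * p" using S by (simp add: S_def sums_def[symmetric] sums_iff)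
    also have "\<dots> < \<infinity>" using Sfin p(2) by (simp add: ennreal_mult_less_top less_top)
    finally show ?thesis .
  qed
  ultimately show ?thesis by blast
qed

context filtered_prob_space
begin

text \<open>\<open>Z 0\<close> is finite but perhaps not integrable. Multiplying the process by
  \<open>inverse (1 + Z 0)\<close>, known at every time, preserves the supermartingale property and
  brings the initial integral down to at most 1.\<close>

lemma supermartingale_AE_convergent_finite:
  assumes Z: "supermartingale Z" and fin: "AE \<omega> in M. Z 0 \<omega> < \<infinity>"
  shows "AE \<omega> in M. \<exists>l<\<infinity>. (\<lambda>n. Z n \<omega>) \<longlonglongrightarrow> l"
proof -
  have Z0[measurable]: "Z 0 \<in> borel_measurable (F n)" for n
    using supermartingaleD(1)[OF Z] by (rule measurable_F_mono) simp
  note [measurable] = supermartingaleD(1)[OF Z]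
  have "supermartingale (\<lambda>n \<omega>. inverse (1 + Z 0 \<omega>) * Z n \<omega>)"
    unfolding supermartingale_def
  proof (intro conjI allI ballI)
    fix n and \<phi> :: "'w \<Rightarrow> ennreal" assume [measurable]: "\<phi> \<in> borel_measurable (F n)"
    show "(\<integral>\<^sup>+\<omega>. \<phi> \<omega> * (inverse (1 + Z 0 \<omega>) * Z (Suc n) \<omega>) \<partial>M)
        \<le> (\<integral>\<^sup>+\<omega>. \<phi> \<omega> * (inverse (1 + Z 0 \<omega>) * Z n \<omega>) \<partial>M)"
      unfolding mult.assoc[symmetric] by (rule supermartingaleD(2)[OF Z]) measurable
  qed measurable
  moreover have "(\<integral>\<^sup>+\<omega>. inverse (1 + Z 0 \<omega>) * Z 0 \<omega> \<partial>M) < \<infinity>"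
  proof -
    have "inverse (1 + z) * z \<le> 1" for z :: ennreal
    proof -
      have "inverse (1 + z) * z \<le> inverse (1 + z) * (1 + z)" by (rule mult_left_mono) auto
      also have "\<dots> \<le> 1"
        by (cases "z = top") (auto simp: mult.commute[of "inverse _"] divide_ennreal_def[symmetric] ennreal_divide_self less_top)
      finally show ?thesis .
    qed
    then have "(\<integral>\<^sup>+\<omega>. inverse (1 + Z 0 \<omega>) * Z 0 \<omega> \<partial>M) \<le> (\<integral>\<^sup>+\<omega>. 1 \<partial>M)" by (intro nn_integral_mono) auto
    then show ?thesis by (simp add: emeasure_space_1) (auto intro: le_less_trans)
  qed
  ultimately have "AE \<omega> in M. \<exists>j::nat. \<forall>k. inverse (1 + Z 0 \<omega>) * Z k \<omega> < of_nat j"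
    by (rule supermartingale_AE_bounded)
  then show ?thesis using supermartingale_AE_convergent[OF Z] fin
  proof eventually_elim
    case (elim \<omega>)
    then obtain j :: nat and l where j: "\<And>k. inverse (1 + Z 0 \<omega>) * Z k \<omega> < of_nat j"
      and l: "(\<lambda>n. Z n \<omega>) \<longlonglongrightarrow> l" by auto
    have f: "1 + Z 0 \<omega> < top" "1 + Z 0 \<omega> \<noteq> 0" using elim by auto
    have "Z k \<omega> \<le> (1 + Z 0 \<omega>) * of_nat j" for k
    proof -
      have "(1 + Z 0 \<omega>) * (inverse (1 + Z 0 \<omega>) * Z k \<omega>) \<le> (1 + Z 0 \<omega>) * of_nat j"
        using j[of k] by (intro mult_left_mono) auto
      then show ?thesis
        using f by (simp add: mult.assoc[symmetric] divide_ennreal_def[symmetric])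
    qed
    then have "l \<le> (1 + Z 0 \<omega>) * of_nat j" using LIMSEQ_le_const2[OF l] by auto
    also have "\<dots> < \<infinity>" using f by (simp add: ennreal_mult_less_top of_nat_less_top)
    finally show ?case using l by auto
  qed
qed

text \<open>Dividing by the product \<open>P\<close> absorbs the factors
  \<open>1 + \<alpha> n\<close>, and the compensation turns the recursion into a supermartingale for
  each error budget \<open>K\<close>. Summability of the errors is only almost sure, so all budgets
  are considered at once.\<close>

theorem robbins_siegmund:
  assumes V[measurable]: "\<And>n. V n \<in> borel_measurable (F n)"
    and \<alpha>[measurable]: "\<And>n. \<alpha> n \<in> borel_measurable (F n)"
    and \<beta>[measurable]: "\<And>n. \<beta> n \<in> borel_measurable (F n)"
    and U[measurable]: "\<And>n. U n \<in> borel_measurable (F n)"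
    and step: "\<And>n. AE \<omega> in M. nn_cond_exp M (F n) (V (Suc n)) \<omega> + U n \<omega> \<le> (1 + \<alpha> n \<omega>) * V n \<omega> + \<beta> n \<omega>"
    and \<alpha>_sum: "AE \<omega> in M. (\<Sum>n. \<alpha> n \<omega>) < \<infinity>"
    and \<beta>_sum: "AE \<omega> in M. (\<Sum>n. \<beta> n \<omega>) < \<infinity>"
    and V0: "AE \<omega> in M. V 0 \<omega> < \<infinity>"
  shows "AE \<omega> in M. (\<Sum>n. U n \<omega>) < \<infinity> \<and> (\<exists>l<\<infinity>. (\<lambda>n. V n \<omega>) \<longlonglongrightarrow> l)"
proof -
  define Z where "Z = (\<lambda>K::nat. \<lambda>n \<omega>. rs_comp (\<lambda>n. \<alpha> n \<omega>) (\<lambda>n. \<beta> n \<omega>) (\<lambda>n. U n \<omega>) (of_nat K) (\<lambda>n. V n \<omega>) n)"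
  have *: "g k \<in> borel_measurable (F n)" if "k \<le> n" "\<And>k. g k \<in> borel_measurable (F k)" for g :: "nat \<Rightarrow> 'w \<Rightarrow> ennreal" and k n
    using that measurable_F_mono by blast
  define P where "P = (\<lambda>n \<omega>. \<Prod>i<n. 1 + \<alpha> i \<omega>)"
  define B where "B = (\<lambda>n \<omega>. \<Sum>k<n. \<beta> k \<omega> / P (Suc k) \<omega>)"
  define S where "S = (\<lambda>n \<omega>. \<Sum>k<n. U k \<omega> / P (Suc k) \<omega>)"
  have Z_eq: "Z K n \<omega> = (if B n \<omega> \<le> of_nat K then V n \<omega> / P n \<omega> + S n \<omega> + (of_nat K - B n \<omega>) else 0)" for K n \<omega>
    unfolding Z_def rs_comp_def B_def S_def P_def ..
  \<comment> \<open>The products and sums stop before their index, so at index \<open>Suc m\<close>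
    they are already known at time \<open>m\<close>.\<close>
  have Pm: "P n \<in> borel_measurable (F m)" if "n \<le> Suc m" for n m
    unfolding P_def using that by (intro borel_measurable_prod_ennreal borel_measurable_add measurable_const *[OF _ \<alpha>]) auto
  have Bm: "B n \<in> borel_measurable (F m)" and Sm: "S n \<in> borel_measurable (F m)" if "n \<le> Suc m" for n m
    unfolding B_def S_def using that
    by (auto intro!: borel_measurable_sum borel_measurable_divide_ennreal Pm *[OF _ \<beta>] *[OF _ U])
  have "supermartingale (Z K)" for K
    unfolding supermartingale_def
  proof (intro conjI allI ballI)
    fix n
    have [measurable]: "P n \<in> borel_measurable (F n)" "B n \<in> borel_measurable (F n)" "S n \<in> borel_measurable (F n)"
      "P (Suc n) \<in> borel_measurable (F n)" "B (Suc n) \<in> borel_measurable (F n)" "S (Suc n) \<in> borel_measurable (F n)"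
      by (auto intro: Pm Bm Sm)
    show "Z K n \<in> borel_measurable (F n)"
      unfolding Z_eq[abs_def] by measurable
    fix \<phi> :: "'w \<Rightarrow> ennreal" assume [measurable]: "\<phi> \<in> borel_measurable (F n)"
    interpret sf: sigma_finite_subalgebra M "F n" by (rule sigma_finite_subalgebra_F)
    \<comment> \<open>Killing at time \<open>Suc n\<close> is decided by \<open>B (Suc n)\<close>,
      hence at time \<open>n\<close>. The weighted process at \<open>Suc n\<close> is therefore
      \<open>\<psi> * V (Suc n) + \<eta>\<close> with both coefficients measurable at time
      \<open>n\<close>.\<close>
    define \<psi> where "\<psi> = (\<lambda>\<omega>. if B (Suc n) \<omega> \<le> of_nat K then \<phi> \<omega> / P (Suc n) \<omega> else 0)"
    define \<eta> where "\<eta> = (\<lambda>\<omega>. if B (Suc n) \<omega> \<le> of_nat K then \<phi> \<omega> * (S (Suc n) \<omega> + (of_nat K - B (Suc n) \<omega>)) else 0)"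
    have \<psi>: "\<psi> \<in> borel_measurable (F n)" and \<eta>: "\<eta> \<in> borel_measurable (F n)"
      unfolding \<psi>_def \<eta>_def by measurable
    have [measurable]: "\<psi> \<in> borel_measurable M" "\<eta> \<in> borel_measurable M" "\<And>n. V n \<in> borel_measurable M"
      using measurable_F_M \<psi> \<eta> V by blast+
    have "(\<integral>\<^sup>+\<omega>. \<phi> \<omega> * Z K (Suc n) \<omega> \<partial>M) = (\<integral>\<^sup>+\<omega>. \<psi> \<omega> * V (Suc n) \<omega> + \<eta> \<omega> \<partial>M)"
      by (intro nn_integral_cong) (auto simp: Z_eq \<psi>_def \<eta>_def divide_ennreal_def algebra_simps)
    also have "\<dots> = (\<integral>\<^sup>+\<omega>. \<psi> \<omega> * V (Suc n) \<omega> \<partial>M) + (\<integral>\<^sup>+\<omega>. \<eta> \<omega> \<partial>M)"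
      by (rule nn_integral_add) measurable
    also have "(\<integral>\<^sup>+\<omega>. \<psi> \<omega> * V (Suc n) \<omega> \<partial>M) = (\<integral>\<^sup>+\<omega>. \<psi> \<omega> * nn_cond_exp M (F n) (V (Suc n)) \<omega> \<partial>M)"
      by (rule sf.nn_cond_exp_intg[symmetric]) (use \<psi> in measurable)
    also have "\<dots> + (\<integral>\<^sup>+\<omega>. \<eta> \<omega> \<partial>M) = (\<integral>\<^sup>+\<omega>. \<psi> \<omega> * nn_cond_exp M (F n) (V (Suc n)) \<omega> + \<eta> \<omega> \<partial>M)"
      by (rule nn_integral_add[symmetric]) (auto intro!: borel_measurable_times_ennreal)
    also have "\<dots> \<le> (\<integral>\<^sup>+\<omega>. \<phi> \<omega> * Z K n \<omega> \<partial>M)"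
    proof (rule nn_integral_mono_AE)
      show "AE \<omega> in M. \<psi> \<omega> * nn_cond_exp M (F n) (V (Suc n)) \<omega> + \<eta> \<omega> \<le> \<phi> \<omega> * Z K n \<omega>"
        using step[of n]
      proof eventually_elim
        case (elim \<omega>)
        show ?case
        proof (cases "B (Suc n) \<omega> \<le> of_nat K")
          case False
          then show ?thesis by (simp add: \<psi>_def \<eta>_def)
        next
          case True
          let ?E = "nn_cond_exp M (F n) (V (Suc n)) \<omega>" and ?P = "P (Suc n) \<omega>" and ?K = "of_nat K :: ennreal"
          have PS: "?P = P n \<omega> * (1 + \<alpha> n \<omega>)" by (simp add: P_def)
          have BS: "B (Suc n) \<omega> = B n \<omega> + \<beta> n \<omega> / ?P" by (simp add: B_def)
          \<comment> \<open>The accumulated errors increase, so a path alive at \<open>Suc n\<close>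
            was alive at \<open>n\<close>.\<close>
          have Bn: "B n \<omega> \<le> ?K" using True unfolding BS by (rule order_trans[rotated]) simp
          have K: "(?K - B (Suc n) \<omega>) + \<beta> n \<omega> / ?P \<le> ?K - B n \<omega>"
          proof -
            have "(?K - B (Suc n) \<omega>) + \<beta> n \<omega> / ?P = ?K - B n \<omega> - \<beta> n \<omega> / ?P + \<beta> n \<omega> / ?P"
              unfolding BS by (simp add: diff_add_eq_diff_diff_swap_ennreal)
            also have "\<beta> n \<omega> / ?P \<le> ?K - B n \<omega>"
              using True unfolding BS by (simp add: ennreal_le_minus_iff add.commute)
            then have "?K - B n \<omega> - \<beta> n \<omega> / ?P + \<beta> n \<omega> / ?P \<le> ?K - B n \<omega>"
              by (simp add: diff_add_self_ennreal)
            finally show ?thesis .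
          qed
          have \<alpha>P: "(1 + \<alpha> n \<omega>) * V n \<omega> / ?P \<le> V n \<omega> / P n \<omega>"
          proof (cases "\<alpha> n \<omega> = top")
            case True
            \<comment> \<open>Here \<open>P (Suc n)\<close> is infinite, and every quotient by
              \<open>top\<close> is 0, including that of \<open>top\<close>.\<close>
            have "P n \<omega> \<noteq> 0" unfolding P_def by auto
            then show ?thesis using True unfolding PS by simp
          next
            case False
            then show ?thesis unfolding PS mult.commute[of "1 + \<alpha> n \<omega>" "V n \<omega>"]
              by (subst divide_mult_eq) auto
          qed
          have "\<psi> \<omega> * ?E + \<eta> \<omega> = \<phi> \<omega> * ((?E + U n \<omega>) / ?P + S n \<omega> + (?K - B (Suc n) \<omega>))"
            using True by (simp add: \<psi>_def \<eta>_def S_def divide_ennreal_def algebra_simps)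
          also have "\<dots> \<le> \<phi> \<omega> * (((1 + \<alpha> n \<omega>) * V n \<omega> + \<beta> n \<omega>) / ?P + S n \<omega> + (?K - B (Suc n) \<omega>))"
            by (intro mult_left_mono add_right_mono divide_right_mono_ennreal elim) auto
          also have "\<dots> = \<phi> \<omega> * ((1 + \<alpha> n \<omega>) * V n \<omega> / ?P + S n \<omega> + ((?K - B (Suc n) \<omega>) + \<beta> n \<omega> / ?P))"
            by (simp add: add_divide_distrib_ennreal add_ac)
          also have "\<dots> \<le> \<phi> \<omega> * (V n \<omega> / P n \<omega> + S n \<omega> + (?K - B n \<omega>))"
            by (intro mult_left_mono add_mono \<alpha>P K order_refl) auto
          also have "\<dots> = \<phi> \<omega> * Z K n \<omega>" using Bn by (simp add: Z_eq)
          finally show ?thesis .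
        qed
      qed
    qed
    finally show "(\<integral>\<^sup>+\<omega>. \<phi> \<omega> * Z K (Suc n) \<omega> \<partial>M) \<le> (\<integral>\<^sup>+\<omega>. \<phi> \<omega> * Z K n \<omega> \<partial>M)" .
  qed
  moreover have "AE \<omega> in M. Z K 0 \<omega> < \<infinity>" for K
    using V0 by eventually_elim (auto simp: Z_eq B_def S_def P_def divide_ennreal_def of_nat_less_top)
  ultimately have "AE \<omega> in M. \<exists>l<\<infinity>. (\<lambda>n. Z K n \<omega>) \<longlonglongrightarrow> l" for K
    by (rule supermartingale_AE_convergent_finite)
  then have "AE \<omega> in M. \<forall>K. \<exists>l<\<infinity>. (\<lambda>n. Z K n \<omega>) \<longlonglongrightarrow> l" by (simp add: AE_all_countable)
  then show ?thesis using \<alpha>_sum \<beta>_sum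
  proof eventually_elim
    case (elim \<omega>)
    show ?case
      by (rule rs_comp_converges_imp[OF elim(2,3)]) (use elim(1) in \<open>auto simp: Z_def\<close>)
  qed
qed

text \<open>The partial sums of \<open>Y\<close> satisfy the Robbins--Siegmund recursion with the
  conditional expectations as additive errors, so they converge to a finite limit.\<close>

lemma AE_suminf_finite_if_cond_exp:
  assumes Y: "\<And>n. Y n \<in> borel_measurable (F (Suc n))"
    and sum: "AE \<omega> in M. (\<Sum>n. nn_cond_exp M (F n) (Y n) \<omega>) < \<infinity>"
  shows "AE \<omega> in M. (\<Sum>n. Y n \<omega>) < \<infinity>"
proof -
  define V where "V = (\<lambda>n \<omega>. \<Sum>k<n. Y k \<omega>)"
  have V: "V n \<in> borel_measurable (F n)" for n
    unfolding V_def by (intro borel_measurable_sum measurable_F_mono[OF Y]) auto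
  have "AE \<omega> in M. (\<Sum>n. 0::ennreal) < \<infinity> \<and> (\<exists>l<\<infinity>. (\<lambda>n. V n \<omega>) \<longlonglongrightarrow> l)"
  proof (rule robbins_siegmund[where \<alpha>="\<lambda>_ _. 0" and \<beta>="\<lambda>n. nn_cond_exp M (F n) (Y n)" and U="\<lambda>_ _. 0"])
    fix n
    interpret sf: sigma_finite_subalgebra M "F n" by (rule sigma_finite_subalgebra_F)
    have [measurable]: "V n \<in> borel_measurable M" "Y n \<in> borel_measurable M"
      using V Y measurable_F_M by blast+
    have "AE \<omega> in M. nn_cond_exp M (F n) (V n) \<omega> + nn_cond_exp M (F n) (Y n) \<omega> = nn_cond_exp M (F n) (\<lambda>\<omega>. V n \<omega> + Y n \<omega>) \<omega>"
      by (rule sf.nn_cond_exp_sum) auto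
    moreover have "(\<lambda>\<omega>. V n \<omega> + Y n \<omega>) = V (Suc n)" by (simp add: V_def)
    ultimately show "AE \<omega> in M. nn_cond_exp M (F n) (V (Suc n)) \<omega> + 0 \<le> (1 + 0) * V n \<omega> + nn_cond_exp M (F n) (Y n) \<omega>"
      using sf.nn_cond_exp_F_meas[OF V] by auto
  qed (use V sum in \<open>auto simp: V_def\<close>)
  then show ?thesis
  proof eventually_elim
    case (elim \<omega>)
    then obtain l where l: "l < \<infinity>" "(\<lambda>n. V n \<omega>) \<longlonglongrightarrow> l" by auto
    have "(\<lambda>n. V n \<omega>) \<longlonglongrightarrow> (\<Sum>n. Y n \<omega>)" unfolding V_def by (rule summable_LIMSEQ) simp
    then show ?case using l LIMSEQ_unique by auto
  qed
qed

end

section \<open>Weak convergence of Fejer monotone sequences\<close>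

text \<open>Nearly norm-minimal points of the sets form a Cauchy sequence by the parallelogram law,
  because the midpoint of two of them stays in the larger set. This plays the part of weak
  compactness of bounded closed convex sets.\<close>

lemma nested_closed_convex_Inter_nonempty:
  fixes C :: "nat \<Rightarrow> 'h::{real_inner, banach} set"
  assumes closed: "\<And>n. closed (C n)" and convex: "\<And>n. convex (C n)"
    and ne: "\<And>n. C n \<noteq> {}" and dec: "\<And>n. C (Suc n) \<subseteq> C n" and bdd: "bounded (C 0)"
  shows "(\<Inter>n. C n) \<noteq> {}"
proof -
  have dec': "C n \<subseteq> C m" if "m \<le> n" for m n using lift_Suc_antimono_le[of C, OF dec that] .
  obtain K where K: "\<And>h. h \<in> C 0 \<Longrightarrow> norm h \<le> K" using bdd by (auto simp: bounded_iff)
  define e where "e = (\<lambda>n. INF h\<in>C n. (norm h)\<^sup>2)"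
  have bb: "bdd_below ((\<lambda>h. (norm h)\<^sup>2) ` C n)" for n by (rule bdd_belowI[of _ 0]) auto
  have e_le: "e n \<le> (norm h)\<^sup>2" if "h \<in> C n" for n h
    unfolding e_def using that by (rule cINF_lower[OF bb])
  have "\<exists>h\<in>C n. (norm h)\<^sup>2 < e n + inverse (real (Suc n))" for n
  proof -
    have "e n < e n + inverse (real (Suc n))" by simp
    then show ?thesis unfolding e_def using cINF_less_iff[OF ne bb] by blast
  qed
  then obtain p where p: "\<And>n. p n \<in> C n" "\<And>n. (norm (p n))\<^sup>2 < e n + inverse (real (Suc n))" by metis
  have inc: "incseq e"
    unfolding incseq_def e_def using dec' ne bb by (auto intro!: cINF_superset_mono)
  have "e n \<le> K\<^sup>2" for n
    using e_le[OF p(1)] K[of "p n"] p(1) dec'[of 0 n] by (meson le0 norm_ge_zero order_trans power_mono subsetD)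
  then obtain L where L: "e \<longlonglongrightarrow> L" "\<And>n. e n \<le> L" using incseq_convergent[OF inc] by blast
  \<comment> \<open>For n at most m, the parallelogram law bounds the squared distance of
    \<open>p m\<close> and \<open>p n\<close> by twice their squared norms minus
    \<open>4 * e n\<close>. The near-minimality errors contribute the four inverses, and
    \<open>e m \<le> L\<close> the rest.\<close>
  define g where "g = (\<lambda>n. 2 * (L - e n) + 4 * inverse (real (Suc n)))"
  have "g \<longlonglongrightarrow> 2 * (L - L) + 4 * 0"
    unfolding g_def by (intro tendsto_intros L LIMSEQ_inverse_real_of_nat)
  then have g0: "g \<longlonglongrightarrow> 0" by simp
  have pg: "(norm (p m - p n))\<^sup>2 \<le> g n" if "n \<le> m" for m n
  proof -
    have "(1/2) *\<^sub>R p m + (1/2) *\<^sub>R p n \<in> C n"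
      using convexD[OF convex[of n], of "p m" "p n" "1/2" "1/2"] p(1)[of n] p(1)[of m] dec'[OF that] by auto
    from e_le[OF this] have "4 * e n \<le> (norm (p m + p n))\<^sup>2"
      by (simp add: scaleR_right_distrib[symmetric] power_divide)
    moreover have "(norm (p m - p n))\<^sup>2 + (norm (p m + p n))\<^sup>2 = 2 * (norm (p m))\<^sup>2 + 2 * (norm (p n))\<^sup>2"
      by (simp add: power2_norm_eq_inner inner_simps inner_commute)
    moreover have "inverse (real (Suc m)) \<le> inverse (real (Suc n))" using that by (simp add: le_imp_inverse_le)
    moreover note p(2)[of m] p(2)[of n] L(2)[of m]
    ultimately show ?thesis
      unfolding g_def right_diff_distrib by linarith
  qed
  have "Cauchy p"
  proof (rule metric_CauchyI)
    fix \<epsilon> :: real assume \<epsilon>: "0 < \<epsilon>"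
    then have "\<forall>\<^sub>F n in sequentially. g n < \<epsilon>\<^sup>2" using g0 by (intro order_tendstoD(2)) auto
    then obtain N where N: "\<And>n. n \<ge> N \<Longrightarrow> g n < \<epsilon>\<^sup>2" by (auto simp: eventually_sequentially)
    have *: "dist (p m) (p n) < \<epsilon>" if "N \<le> n" "n \<le> m" for m n
      using pg[OF that(2)] N[OF that(1)] \<epsilon> unfolding dist_norm by (meson le_less_trans less_imp_le power_less_imp_less_base)
    show "\<exists>N. \<forall>m\<ge>N. \<forall>n\<ge>N. dist (p m) (p n) < \<epsilon>"
      by (metis * dist_commute nat_le_linear)
  qed
  then obtain l where l: "p \<longlonglongrightarrow> l" using Cauchy_convergent convergent_def by blast
  have "l \<in> C n" for n
  proof (rule closed_sequentially[OF closed])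
    show "(\<lambda>k. p (k + n)) \<longlonglongrightarrow> l" using l by (rule LIMSEQ_ignore_initial_segment)
    show "p (k + n) \<in> C n" for k using p(1)[of "k + n"] dec'[of n "k + n"] by auto
  qed
  then show ?thesis by auto
qed

text \<open>Weak cluster points are replaced by the points common to all closed convex hulls of tails of a
  subsequence, which avoids weak compactness.\<close>

lemma fejer_imp_weakly_tendsto:
  fixes x :: "nat \<Rightarrow> 'h::{real_inner, banach}"
  assumes conv: "\<And>z. z \<in> S \<Longrightarrow> convergent (\<lambda>n. (norm (x n - z))\<^sup>2)" and "S \<noteq> {}"
    and cluster: "\<And>r p. strict_mono (r :: nat \<Rightarrow> nat) \<Longrightarrow>
        (\<And>C n. closed C \<Longrightarrow> convex C \<Longrightarrow> (\<And>k. n \<le> k \<Longrightarrow> x (r k) \<in> C) \<Longrightarrow> p \<in> C) \<Longrightarrow> p \<in> S"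
  shows "\<exists>p\<in>S. weakly_tendsto x p"
proof -
  obtain z0 where z0: "z0 \<in> S" using \<open>S \<noteq> {}\<close> by auto
  have bdd: "bounded (range x)"
  proof -
    have "Bseq (\<lambda>n. (norm (x n - z0))\<^sup>2)" using conv[OF z0] by (rule convergent_imp_Bseq)
    then obtain K where K: "K > 0" "\<And>n. (norm (x n - z0))\<^sup>2 \<le> K" by (auto simp: Bseq_def)
    have "norm (x n) \<le> norm z0 + sqrt K" for n
      using K(2)[of n] norm_triangle_ineq[of z0 "x n - z0"] real_le_rsqrt[OF K(2)[of n]] by auto
    then show ?thesis by (auto simp: bounded_iff)
  qed
  define clus where "clus = (\<lambda>(r :: nat \<Rightarrow> nat) p.
     \<forall>C n. closed C \<longrightarrow> convex C \<longrightarrow> (\<forall>k\<ge>n. x (r k) \<in> C) \<longrightarrow> p \<in> C)"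
  have clus_S: "p \<in> S" if "strict_mono r" "clus r p" for r p
    using cluster[OF that(1)] that(2) unfolding clus_def by blast
  have clus_ex: "\<exists>p. clus r p" if "strict_mono r" for r
  proof -
    define C where "C = (\<lambda>n. closure (convex hull ((\<lambda>k. x (r k)) ` {n..})))"
    have "(\<Inter>n. C n) \<noteq> {}"
    proof (rule nested_closed_convex_Inter_nonempty)
      show "C (Suc n) \<subseteq> C n" for n unfolding C_def by (intro closure_mono hull_mono) auto
      have "bounded ((\<lambda>k. x (r k)) ` {0..})" using bdd by (rule bounded_subset) auto
      then show "bounded (C 0)" unfolding C_def by (intro bounded_closure bounded_convex_hull)
    qed (auto simp: C_def convex_closure)
    then obtain p where p: "\<And>n. p \<in> C n" by auto
    have "clus r p" unfolding clus_def
    proof (intro allI impI)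
      fix D n assume "closed D" "convex D" "\<forall>k\<ge>n. x (r k) \<in> D"
      then have "C n \<subseteq> D" unfolding C_def by (intro closure_minimal hull_minimal) auto
      then show "p \<in> D" using p by auto
    qed
    then show ?thesis ..
  qed
  \<comment> \<open>Half-spaces are closed and convex, so a linear bound on a tail passes to the
    cluster point.\<close>
  have clus_le: "h \<bullet> p \<le> c" if "clus r p" "\<And>k. k \<ge> n \<Longrightarrow> h \<bullet> x (r k) \<le> c" for h p c r n
    using that(1)[unfolded clus_def, rule_format, OF closed_halfspace_le convex_halfspace_le, of n h c] that(2) by auto
  have clus_lim: "h \<bullet> p = L" if "clus r p" "strict_mono r" "(\<lambda>n. h \<bullet> x n) \<longlonglongrightarrow> L" for h p L r
  proof -
    have lim: "(\<lambda>n. h \<bullet> x (r n)) \<longlonglongrightarrow> L" using LIMSEQ_subseq_LIMSEQ[OF that(3,2)] by (simp add: o_def)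
    have le: "h \<bullet> p \<le> L + \<epsilon>" if "0 < \<epsilon>" for \<epsilon>
    proof -
      have "\<forall>\<^sub>F n in sequentially. h \<bullet> x (r n) < L + \<epsilon>" using lim that by (intro order_tendstoD(2)) auto
      then obtain n where "\<And>k. k \<ge> n \<Longrightarrow> h \<bullet> x (r k) < L + \<epsilon>" by (auto simp: eventually_sequentially)
      then show ?thesis using clus_le[OF \<open>clus r p\<close>, of n h "L + \<epsilon>"] by (meson less_imp_le)
    qed
    have "- h \<bullet> p \<le> - L + \<epsilon>" if "0 < \<epsilon>" for \<epsilon>
    proof -
      have "\<forall>\<^sub>F n in sequentially. L - \<epsilon> < h \<bullet> x (r n)" using lim that by (intro order_tendstoD(1)) auto
      then obtain n where n: "\<And>k. k \<ge> n \<Longrightarrow> L - \<epsilon> < h \<bullet> x (r k)" by (auto simp: eventually_sequentially)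
      show ?thesis using n by (intro clus_le[OF \<open>clus r p\<close>, of n]) fastforce
    qed
    then have "L \<le> h \<bullet> p + \<epsilon>" if "0 < \<epsilon>" for \<epsilon> using that by fastforce
    with le show ?thesis by (meson antisym field_le_epsilon)
  qed
  have uniq: "p = q" if "clus r p" "clus s q" "strict_mono r" "strict_mono s" for p q r s
  proof -
    have pS: "p \<in> S" "q \<in> S" using clus_S that by auto
    \<comment> \<open>The difference of the squared distances to \<open>p\<close> and
      \<open>q\<close> is affine in \<open>x n\<close>, so the inner products with
      \<open>p - q\<close> converge along the whole sequence and both cluster points must realize
      the same limit.\<close>
    have eq: "(p - q) \<bullet> x n = ((norm (x n - q))\<^sup>2 - (norm (x n - p))\<^sup>2 + (norm p)\<^sup>2 - (norm q)\<^sup>2) / 2" for n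
      by (simp add: power2_norm_eq_inner inner_simps inner_commute)
    obtain a b where "(\<lambda>n. (norm (x n - q))\<^sup>2) \<longlonglongrightarrow> a" "(\<lambda>n. (norm (x n - p))\<^sup>2) \<longlonglongrightarrow> b"
      using conv[OF pS(1)] conv[OF pS(2)] by (auto simp: convergent_def)
    then have lim: "(\<lambda>n. (p - q) \<bullet> x n) \<longlonglongrightarrow> (a - b + (norm p)\<^sup>2 - (norm q)\<^sup>2) / 2"
      unfolding eq by (intro tendsto_intros) auto
    have "(p - q) \<bullet> p = (p - q) \<bullet> q"
      using clus_lim[OF that(1,3) lim] clus_lim[OF that(2,4) lim] by simp
    then have "(p - q) \<bullet> (p - q) = 0" by (simp add: inner_simps)
    then show ?thesis by simp
  qed
  obtain p where p: "clus id p" using clus_ex[of id] by (auto simp: strict_mono_def)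
  \<comment> \<open>Indices violating the bound infinitely often would form a subsequence. Its
    cluster point is \<open>p\<close> by uniqueness, yet lies in the opposite half-space.\<close>
  have up: "\<forall>\<^sub>F n in sequentially. h \<bullet> x n < c" if "h \<bullet> p < c" for h c
  proof (rule ccontr)
    assume "\<not> ?thesis"
    then have "infinite {n. \<not> h \<bullet> x n < c}"
      unfolding not_eventually cofinite_eq_sequentially[symmetric] frequently_cofinite .
    from infinite_enumerate[OF this] obtain r :: "nat \<Rightarrow> nat"
      where r: "strict_mono r" "\<And>n. \<not> h \<bullet> x (r n) < c" by auto
    obtain q where q: "clus r q" using clus_ex[OF r(1)] by auto
    have "p = q" using uniq[OF p q _ r(1)] by (auto simp: strict_mono_def)
    moreover have "- h \<bullet> q \<le> - c" using r(2) by (intro clus_le[OF q, of 0]) (auto simp: not_less)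
    ultimately show False using that by simp
  qed
  have "weakly_tendsto x p"
    unfolding weakly_tendsto_def
  proof
    fix h show "(\<lambda>n. x n \<bullet> h) \<longlonglongrightarrow> p \<bullet> h"
      using up[of h] up[of "- h" "- c" for c]
      by (intro order_tendstoI) (auto simp: inner_commute)
  qed
  moreover have "p \<in> S" using clus_S[OF _ p] by (auto simp: strict_mono_def)
  ultimately show ?thesis by auto
qed

text \<open>The distance to \<open>z\<close> is 1-Lipschitz in \<open>z\<close>, so the Cauchy
  property passes to the closure. This extends an almost sure statement over a countable set of
  minimizers to all of them.\<close>

lemma convergent_norm_diff_dense:
  fixes x :: "nat \<Rightarrow> 'h::real_inner"
  assumes D: "\<And>z. z \<in> D \<Longrightarrow> convergent (\<lambda>n. (norm (x n - z))\<^sup>2)" and "S \<subseteq> closure D" and z: "z \<in> S"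
  shows "convergent (\<lambda>n. (norm (x n - z))\<^sup>2)"
proof -
  have "Cauchy (\<lambda>n. norm (x n - z))"
  proof (rule metric_CauchyI)
    fix \<epsilon> :: real assume "0 < \<epsilon>"
    then obtain d where d: "d \<in> D" "dist d z < \<epsilon> / 3"
      using assms closure_approachable[of z D] by (metis divide_pos_pos subsetD zero_less_numeral)
    have "convergent (\<lambda>n. sqrt ((norm (x n - d))\<^sup>2))"
      using D[OF d(1)] by (auto simp: convergent_def simp del: real_sqrt_abs real_sqrt_pow2 intro: tendsto_real_sqrt)
    then have "Cauchy (\<lambda>n. norm (x n - d))" by (simp add: convergent_Cauchy)
    then obtain N where N: "\<And>m n. m \<ge> N \<Longrightarrow> n \<ge> N \<Longrightarrow> dist (norm (x m - d)) (norm (x n - d)) < \<epsilon> / 3"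
      using \<open>0 < \<epsilon>\<close> by (meson metric_CauchyD divide_pos_pos zero_less_numeral)
    have *: "\<bar>norm (x m - z) - norm (x m - d)\<bar> < \<epsilon> / 3" for m
      using norm_triangle_ineq3[of "x m - z" "x m - d"] d(2) by (simp add: dist_norm)
    have "dist (norm (x m - z)) (norm (x n - z)) < \<epsilon>" if "m \<ge> N" "n \<ge> N" for m n
      using N[OF that] *[of m] *[of n] unfolding dist_real_def by linarith
    then show "\<exists>N. \<forall>m\<ge>N. \<forall>n\<ge>N. dist (norm (x m - z)) (norm (x n - z)) < \<epsilon>" by blast
  qed
  then obtain L where "(\<lambda>n. norm (x n - z)) \<longlonglongrightarrow> L" using Cauchy_convergent convergent_def by blast
  then have "(\<lambda>n. (norm (x n - z))\<^sup>2) \<longlonglongrightarrow> L\<^sup>2" by (rule tendsto_power)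
  then show ?thesis by (rule convergentI)
qed

section \<open>Sublevel sets and minima of functions in \<open>Gamma0\<close>\<close>

lemma Gamma0_sublevel_closed:
  assumes "f \<in> Gamma0" shows "closed {h. f h \<le> c}"
proof -
  have "open {h. c < f h}"
  proof (subst open_subopen, intro ballI)
    fix h assume "h \<in> {h. c < f h}"
    moreover have "f h \<le> Liminf (nhds h) f" using assms by (simp add: Gamma0_def)
    ultimately have "c < Liminf (nhds h) f" by auto
    then have "\<forall>\<^sub>F k in nhds h. c < f k" by (rule less_LiminfD)
    then show "\<exists>T. open T \<and> h \<in> T \<and> T \<subseteq> {h. c < f h}" unfolding eventually_nhds by blast
  qed
  moreover have "{h. c < f h} = - {h. f h \<le> c}" by auto
  ultimately show ?thesis by (simp add: closed_def)
qed

lemma Gamma0_sublevel_convex: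
  assumes "f \<in> Gamma0" shows "convex {h. f h \<le> ereal c}"
proof (rule convexI)
  fix h k and u v :: real
  assume hk: "h \<in> {h. f h \<le> ereal c}" "k \<in> {h. f h \<le> ereal c}" and uv: "0 \<le> u" "0 \<le> v" "u + v = 1"
  show "u *\<^sub>R h + v *\<^sub>R k \<in> {h. f h \<le> ereal c}"
  proof (cases "u = 0 \<or> v = 0")
    case True then show ?thesis using hk uv by auto
  next
    case False
    then have u: "u \<in> {0<..<1}" "v = 1 - u" using uv by auto
    then have "f (u *\<^sub>R h + v *\<^sub>R k) \<le> ereal u * f h + ereal v * f k"
      using assms unfolding Gamma0_def by blast
    also have "\<dots> \<le> ereal u * ereal c + ereal v * ereal c"
      using hk uv by (intro add_mono ereal_mult_left_mono) auto
    also have "\<dots> = ereal c" using u by (simp add: left_diff_distrib)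
    finally show ?thesis by simp
  qed
qed

lemma Gamma0_borel_measurable:
  assumes "f \<in> Gamma0" shows "f \<in> borel_measurable borel"
proof (rule borel_measurableI_le)
  fix c show "{h \<in> space borel. f h \<le> c} \<in> sets borel"
    using Gamma0_sublevel_closed[OF assms] by simp
qed

lemma Gamma0_min_ereal:
  assumes "f \<in> Gamma0" "z \<in> Argmin f"
  obtains m where "f z = ereal m" "\<And>h. ereal m \<le> f h" "(INF h. f h) = ereal m"
proof -
  have z: "f z \<le> f h" for h using assms(2) by (simp add: Argmin_def)
  obtain k where "f k \<noteq> \<infinity>" using assms(1) by (auto simp: Gamma0_def)
  moreover have "f z \<noteq> -\<infinity>" using assms(1) by (auto simp: Gamma0_def)
  ultimately obtain m where m: "f z = ereal m" using z[of k] by (cases "f z") auto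
  moreover have "(INF h. f h) = f z" by (rule antisym) (auto intro: INF_lower INF_greatest z)
  ultimately show thesis using that z by metis
qed

text \<open>Each sublevel set above the minimum is closed and convex and contains a tail of the
  sequence, so it contains every cluster point.\<close>

lemma weakly_tendsto_minimizer:
  fixes f :: "'h::{real_inner, banach} \<Rightarrow> ereal"
  assumes f: "f \<in> Gamma0" and min: "f z0 = ereal m" "\<And>h. ereal m \<le> f h"
    and dist: "\<And>z. z \<in> Argmin f \<Longrightarrow> convergent (\<lambda>n. (norm (x n - z))\<^sup>2)"
    and lim: "(\<lambda>n. f (x n)) \<longlonglongrightarrow> ereal m"
  shows "\<exists>p\<in>Argmin f. weakly_tendsto x p"
proof (rule fejer_imp_weakly_tendsto[OF dist])
  show "Argmin f \<noteq> {}" using min by (auto simp: Argmin_def intro!: exI[of _ z0])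
  fix r :: "nat \<Rightarrow> nat" and p
  assume r: "strict_mono r" and p: "\<And>C n. closed C \<Longrightarrow> convex C \<Longrightarrow> (\<And>k. n \<le> k \<Longrightarrow> x (r k) \<in> C) \<Longrightarrow> p \<in> C"
  have "f p \<le> ereal m + ereal \<epsilon>" if "0 < \<epsilon>" for \<epsilon>
  proof -
    have "\<forall>\<^sub>F n in sequentially. f (x n) < ereal (m + \<epsilon>)" using lim that by (intro order_tendstoD(2)) auto
    then obtain n where n: "\<And>k. k \<ge> n \<Longrightarrow> f (x k) < ereal (m + \<epsilon>)" by (auto simp: eventually_sequentially)
    have "p \<in> {h. f h \<le> ereal (m + \<epsilon>)}"
      by (rule p[OF Gamma0_sublevel_closed[OF f] Gamma0_sublevel_convex[OF f], of n])
         (auto intro!: less_imp_le[OF n] order_trans[OF _ seq_suble[OF r]])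
    then show ?thesis by simp
  qed
  then have "f p \<le> ereal m" by (rule ereal_le_epsilon2)
  then show "p \<in> Argmin f" using min(2) by (auto simp: Argmin_def intro: order_trans)
qed

section \<open>Divergent weights\<close>

text \<open>A positive limit would bound \<open>\<gamma> n * a n\<close> from below by a multiple of
  \<open>\<gamma> n / w n\<close> on a tail. The limit may be infinite, so a finite positive
  constant strictly below it is chosen.\<close>

lemma weighted_limit_eq_0:
  fixes a :: "nat \<Rightarrow> ennreal"
  assumes \<gamma>: "\<And>n. 0 < \<gamma> n" and w: "\<And>n. 0 < w n" and div: "\<not> summable (\<lambda>n. \<gamma> n / w n)"
    and sum: "(\<Sum>n. ennreal (\<gamma> n) * a n) < \<infinity>" and lim: "(\<lambda>n. ennreal (w n) * a n) \<longlonglongrightarrow> l"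
  shows "l = 0"
proof (rule ccontr)
  assume "l \<noteq> 0"
  then have "0 < l" by (simp add: zero_less_iff_neq_zero)
  then obtain c :: rat where c: "0 < ennreal (of_rat c)" "ennreal (of_rat c) < l" using ennreal_rat_dense by blast
  have c0: "0 < real_of_rat c" using c(1) by simp
  obtain N where N: "\<And>n. n \<ge> N \<Longrightarrow> ennreal (of_rat c) < ennreal (w n) * a n"
    using order_tendstoD(1)[OF lim c(2)] by (auto simp: eventually_sequentially)
  have le: "ennreal (of_rat c * (\<gamma> (n + N) / w (n + N))) \<le> ennreal (\<gamma> (n + N)) * a (n + N)" for n
  proof -
    have "ennreal (of_rat c * (\<gamma> (n + N) / w (n + N))) = ennreal (\<gamma> (n + N) / w (n + N)) * ennreal (of_rat c)"
      using c0 \<gamma>[of "n + N"] w[of "n + N"] by (simp add: ennreal_mult[symmetric] mult.commute)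
    also have "\<dots> \<le> ennreal (\<gamma> (n + N) / w (n + N)) * (ennreal (w (n + N)) * a (n + N))"
      using N[of "n + N"] by (intro mult_left_mono) auto
    also have "\<dots> = ennreal (\<gamma> (n + N)) * a (n + N)"
      using \<gamma>[of "n + N"] w[of "n + N"] by (simp add: mult.assoc[symmetric] ennreal_mult[symmetric])
    finally show ?thesis .
  qed
  have "(\<Sum>n. ennreal (of_rat c * (\<gamma> (n + N) / w (n + N)))) \<le> (\<Sum>n. ennreal (\<gamma> (n + N)) * a (n + N))"
    by (intro suminf_le le) auto
  also have "\<dots> \<le> (\<Sum>n. ennreal (\<gamma> n) * a n)"
    using suminf_offset[of "\<lambda>n. ennreal (\<gamma> n) * a n" N] by (simp add: add_increasing)
  finally have "(\<Sum>n. ennreal (of_rat c * (\<gamma> (n + N) / w (n + N)))) \<noteq> top" using sum by (auto simp: top_unique)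
  then have "summable (\<lambda>n. of_rat c * (\<gamma> (n + N) / w (n + N)) :: real)"
    using c0 \<gamma> w by (intro summable_suminf_not_top) (auto intro!: mult_nonneg_nonneg divide_nonneg_nonneg less_imp_le)
  then have "summable (\<lambda>n. \<gamma> (n + N) / w (n + N))" using c0 by (subst (asm) summable_cmult_iff) auto
  then show False using div summable_iff_shift[of "\<lambda>n. \<gamma> n / w n" N] by simp
qed

text \<open>The Abel--Dini argument: a block of indices along which the partial sum more than
  doubles contributes more than 1/2, since each denominator is at most the last one, and such blocks
  exist arbitrarily far out.\<close>

lemma not_summable_divide_partial_sums:
  fixes \<gamma> :: "nat \<Rightarrow> real"
  assumes \<gamma>: "\<And>n. 0 < \<gamma> n" and div: "\<not> summable \<gamma>"
  shows "\<not> summable (\<lambda>n. \<gamma> n / (\<Sum>k\<le>n. \<gamma> k))"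
proof
  define \<theta> where "\<theta> = (\<lambda>n. \<Sum>k\<le>n. \<gamma> k)"
  assume "summable (\<lambda>n. \<gamma> n / (\<Sum>k\<le>n. \<gamma> k))"
  then obtain N where N: "\<And>m n. m \<ge> N \<Longrightarrow> norm (\<Sum>k\<in>{m..<n}. \<gamma> k / \<theta> k) < 1 / 2"
    unfolding summable_Cauchy \<theta>_def by (meson half_gt_zero zero_less_one)
  have \<theta>0: "0 < \<theta> n" for n unfolding \<theta>_def using \<gamma> by (intro sum_pos) auto
  have "\<exists>n. 2 * \<theta> N < \<theta> n"
  proof (rule ccontr)
    assume "\<not> ?thesis"
    then have "\<theta> n \<le> 2 * \<theta> N" for n by (simp add: not_less)
    then show False using div bounded_imp_summable[of \<gamma>] \<gamma> unfolding \<theta>_def by (blast intro: less_imp_le)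
  qed
  then obtain n where n: "2 * \<theta> N < \<theta> n" by auto
  have Nn: "N \<le> n"
  proof (rule ccontr)
    assume "\<not> N \<le> n"
    then have "\<theta> n \<le> \<theta> N" unfolding \<theta>_def using \<gamma> by (intro sum_mono2) (auto intro: less_imp_le)
    then show False using n \<theta>0[of N] by auto
  qed
  have "\<theta> n - \<theta> N = (\<Sum>k\<in>{Suc N..<Suc n}. \<gamma> k)"
  proof -
    have "{..n} = {..N} \<union> {Suc N..<Suc n}" using Nn by auto
    then have "\<theta> n = \<theta> N + (\<Sum>k\<in>{Suc N..<Suc n}. \<gamma> k)"
      unfolding \<theta>_def by (simp only:) (subst sum.union_disjoint, auto)
    then show ?thesis by simp
  qed
  then have "1 - \<theta> N / \<theta> n = (\<Sum>k\<in>{Suc N..<Suc n}. \<gamma> k / \<theta> n)"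
    using \<theta>0[of n] by (simp only: sum_divide_distrib[symmetric]) (simp add: diff_divide_distrib del: sum.op_ivl_Suc flip: \<open>\<theta> n - \<theta> N = _\<close>)
  also have "\<dots> \<le> (\<Sum>k\<in>{Suc N..<Suc n}. \<gamma> k / \<theta> k)"
  proof (intro sum_mono divide_left_mono)
    fix k assume "k \<in> {Suc N..<Suc n}"
    then show "\<theta> k \<le> \<theta> n" unfolding \<theta>_def using \<gamma> by (intro sum_mono2) (auto intro: less_imp_le)
  qed (use \<theta>0 \<gamma> in \<open>auto intro: less_imp_le mult_pos_pos\<close>)
  also have "\<dots> < 1 / 2" using N[of "Suc N" "Suc n"] by (simp del: sum.op_ivl_Suc)
  finally have "1 / 2 < \<theta> N / \<theta> n" by simp
  then show False using n \<theta>0[of n] by (simp add: field_simps)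
qed

section \<open>Weak limits of random variables\<close>

text \<open>Membership in an open set means positive distance to its complement, and a countable
  dense subset of the complement detects this.\<close>

lemma borel_measurable_dist_imp:
  fixes z :: "'w \<Rightarrow> 'h::{metric_space, second_countable_topology}"
  assumes dist: "\<And>a. (\<lambda>\<omega>. dist (z \<omega>) a) \<in> borel_measurable M"
  shows "z \<in> borel_measurable M"
proof (rule borel_measurableI)
  fix U :: "'h set" assume "open U"
  obtain D where D: "countable D" "D \<subseteq> - U" "- U \<subseteq> closure D" by (rule separable)
  note [measurable] = dist
  have "z -` U \<inter> space M = {\<omega>\<in>space M. \<exists>k::nat. \<forall>d\<in>D. inverse (real (Suc k)) \<le> dist (z \<omega>) d}"
  proof (intro set_eqI iffI; clarsimp)
    fix \<omega> assume "\<omega> \<in> space M" "z \<omega> \<in> U"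
    then obtain e where e: "0 < e" "\<And>y. dist y (z \<omega>) < e \<Longrightarrow> y \<in> U" using \<open>open U\<close> by (meson open_dist)
    obtain k where k: "inverse (real (Suc k)) < e" using reals_Archimedean e by blast
    show "\<exists>k::nat. \<forall>d\<in>D. inverse (1 + real k) \<le> dist (z \<omega>) d"
    proof (intro exI ballI)
      fix d assume "d \<in> D"
      then have "d \<notin> U" using D(2) by auto
      then have "e \<le> dist (z \<omega>) d" using e(2)[of d] by (metis dist_commute not_le)
      then show "inverse (1 + real k) \<le> dist (z \<omega>) d" using k by simp
    qed
  next
    fix \<omega> and k :: nat assume k: "\<forall>d\<in>D. inverse (1 + real k) \<le> dist (z \<omega>) d"
    show "z \<omega> \<in> U"
    proof (rule ccontr)
      assume "z \<omega> \<notin> U"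
      then have "z \<omega> \<in> closure D" using D by auto
      then obtain d where "d \<in> D" "dist d (z \<omega>) < inverse (1 + real k)"
        unfolding closure_approachable by (metis inverse_positive_iff_positive of_nat_Suc of_nat_0_less_iff zero_less_Suc)
      then show False using k by (force simp: dist_commute)
    qed
  qed
  also have "\<dots> \<in> sets M"
    using D(1) by measurable
  finally show "z -` U \<inter> space M \<in> sets M" .
qed

text \<open>By Cauchy--Schwarz the ball of radius \<open>c\<close> about \<open>a\<close> is an
  intersection of half-spaces. Continuity reduces their normals to a countable dense set, and the
  normal \<open>z \<omega> - a\<close> gives the converse inclusion.\<close>

lemma borel_measurable_inner_imp:
  fixes z :: "'w \<Rightarrow> 'h::{real_inner, second_countable_topology}"
  assumes inner: "\<And>h. (\<lambda>\<omega>. z \<omega> \<bullet> h) \<in> borel_measurable M"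
  shows "z \<in> borel_measurable M"
proof (rule borel_measurable_dist_imp, rule borel_measurableI_le)
  fix a :: 'h and c :: real
  show "{\<omega>\<in>space M. dist (z \<omega>) a \<le> c} \<in> sets M"
  proof (cases "0 \<le> c")
    case True
    obtain D :: "'h set" where D: "countable D" "UNIV \<subseteq> closure D" by (rule separable)
    note [measurable] = inner
    have "{\<omega>\<in>space M. dist (z \<omega>) a \<le> c} = {\<omega>\<in>space M. \<forall>d\<in>D. z \<omega> \<bullet> d - a \<bullet> d \<le> c * norm d}"
    proof (intro Collect_cong conj_cong iffI refl)
      fix \<omega> assume "dist (z \<omega>) a \<le> c"
      then show "\<forall>d\<in>D. z \<omega> \<bullet> d - a \<bullet> d \<le> c * norm d"
        unfolding inner_diff_left[symmetric] dist_norm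
        by (meson mult_right_mono norm_cauchy_schwarz norm_ge_zero order_trans)
    next
      fix \<omega> assume D_le: "\<forall>d\<in>D. z \<omega> \<bullet> d - a \<bullet> d \<le> c * norm d"
      have "closed {d. z \<omega> \<bullet> d - a \<bullet> d \<le> c * norm d}" by (intro closed_Collect_le continuous_intros)
      then have "closure D \<subseteq> {d. z \<omega> \<bullet> d - a \<bullet> d \<le> c * norm d}" using D_le by (intro closure_minimal) auto
      then have "z \<omega> \<bullet> d - a \<bullet> d \<le> c * norm d" for d using D(2) by auto
      from this[of "z \<omega> - a"] have "norm (z \<omega> - a) * norm (z \<omega> - a) \<le> c * norm (z \<omega> - a)"
        unfolding inner_diff_left[symmetric] power2_norm_eq_inner[symmetric] power2_eq_square .
      then show "dist (z \<omega>) a \<le> c"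
        using True by (cases "norm (z \<omega> - a) = 0") (auto simp: dist_norm)
    qed
    also have "\<dots> \<in> sets M" using D(1) by measurable
    finally show ?thesis .
  next
    case False
    then have "{\<omega>\<in>space M. dist (z \<omega>) a \<le> c} = {}" using zero_le_dist order_trans by blast
    then show ?thesis by (simp only: sets.empty_sets)
  qed
qed

section \<open>Square-integrable random variables and their weak limits\<close>

lemma norm_diff_squared_le:
  fixes p q :: "'h::real_inner"
  shows "(norm (p - q))\<^sup>2 \<le> 2 * (norm p)\<^sup>2 + 2 * (norm q)\<^sup>2"
  using zero_le_power2[of "norm (p + q)"] by (simp add: power2_norm_eq_inner inner_simps inner_commute)

lemma L2_diff:
  fixes u v :: "'w \<Rightarrow> 'h::{real_inner, second_countable_topology}"
  assumes "u \<in> L2 M M" "v \<in> L2 M M"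
  shows "(\<lambda>\<omega>. u \<omega> - v \<omega>) \<in> L2 M M"
proof -
  have [measurable]: "u \<in> borel_measurable M" "v \<in> borel_measurable M"
    and i: "integrable M (\<lambda>\<omega>. (norm (u \<omega>))\<^sup>2)" "integrable M (\<lambda>\<omega>. (norm (v \<omega>))\<^sup>2)"
    using assms by (auto simp: L2_def)
  have "integrable M (\<lambda>\<omega>. (norm (u \<omega> - v \<omega>))\<^sup>2)"
  proof (rule Bochner_Integration.integrable_bound)
    show "integrable M (\<lambda>\<omega>. 2 * (norm (u \<omega>))\<^sup>2 + 2 * (norm (v \<omega>))\<^sup>2)" using i by simp
    show "AE \<omega> in M. norm ((norm (u \<omega> - v \<omega>))\<^sup>2) \<le> norm (2 * (norm (u \<omega>))\<^sup>2 + 2 * (norm (v \<omega>))\<^sup>2)"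
      by (simp add: norm_diff_squared_le)
  qed measurable
  then show ?thesis by (simp add: L2_def)
qed

lemma L2_inner_integrable:
  fixes u v :: "'w \<Rightarrow> 'h::{real_inner, second_countable_topology}"
  assumes "u \<in> L2 M M" "v \<in> L2 M M"
  shows "integrable M (\<lambda>\<omega>. u \<omega> \<bullet> v \<omega>)"
proof -
  have [measurable]: "u \<in> borel_measurable M" "v \<in> borel_measurable M"
    and i: "integrable M (\<lambda>\<omega>. (norm (u \<omega>))\<^sup>2)" "integrable M (\<lambda>\<omega>. (norm (v \<omega>))\<^sup>2)"
    using assms by (auto simp: L2_def)
  show ?thesis
  proof (rule Bochner_Integration.integrable_bound)
    show "integrable M (\<lambda>\<omega>. (norm (u \<omega>))\<^sup>2 + (norm (v \<omega>))\<^sup>2)" using i by simp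
    have "\<bar>p \<bullet> q\<bar> \<le> (norm p)\<^sup>2 + (norm q)\<^sup>2" for p q :: 'h
    proof -
      have "\<bar>p \<bullet> q\<bar> \<le> norm p * norm q" by (rule Cauchy_Schwarz_ineq2)
      also have "\<dots> \<le> (norm p)\<^sup>2 + (norm q)\<^sup>2"
        using sum_squares_bound[of "norm p" "norm q"] mult_nonneg_nonneg[OF norm_ge_zero[of p] norm_ge_zero[of q]] by linarith
      finally show ?thesis .
    qed
    then show "AE \<omega> in M. norm (u \<omega> \<bullet> v \<omega>) \<le> norm ((norm (u \<omega>))\<^sup>2 + (norm (v \<omega>))\<^sup>2)" by auto
  qed measurable
qed

text \<open>The squared norm of \<open>u\<close> dominates
  \<open>2 * (u \<bullet> l) - (norm l)\<^sup>2\<close>, which is affine in \<open>u\<close> and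
  tends to the squared norm of \<open>l\<close> under weak convergence. Fatou's lemma then bounds
  the second moment of the limit.\<close>

lemma weakly_tendsto_limit_L2:
  fixes u :: "nat \<Rightarrow> 'w \<Rightarrow> 'h::{real_inner, second_countable_topology}"
  assumes [measurable]: "\<And>n. u n \<in> borel_measurable M" "l \<in> borel_measurable M"
    and lim: "AE \<omega> in M. weakly_tendsto (\<lambda>n. u n \<omega>) (l \<omega>)"
    and bound: "\<And>n. (\<integral>\<^sup>+\<omega>. ennreal ((norm (u n \<omega>))\<^sup>2) \<partial>M) \<le> C" and "C < \<infinity>"
  shows "l \<in> L2 M M"
proof -
  have "(\<integral>\<^sup>+\<omega>. ennreal ((norm (l \<omega>))\<^sup>2) \<partial>M) = (\<integral>\<^sup>+\<omega>. liminf (\<lambda>n. ennreal (2 * (u n \<omega> \<bullet> l \<omega>) - (norm (l \<omega>))\<^sup>2)) \<partial>M)"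
  proof (rule nn_integral_cong_AE)
    show "AE \<omega> in M. ennreal ((norm (l \<omega>))\<^sup>2) = liminf (\<lambda>n. ennreal (2 * (u n \<omega> \<bullet> l \<omega>) - (norm (l \<omega>))\<^sup>2))"
      using lim
    proof eventually_elim
      case (elim \<omega>)
      have "(\<lambda>n. ennreal (2 * (u n \<omega> \<bullet> l \<omega>) - (norm (l \<omega>))\<^sup>2)) \<longlonglongrightarrow> ennreal (2 * (l \<omega> \<bullet> l \<omega>) - (norm (l \<omega>))\<^sup>2)"
        using elim by (intro tendsto_ennrealI tendsto_diff tendsto_mult tendsto_const) (auto simp: weakly_tendsto_def)
      also have "2 * (l \<omega> \<bullet> l \<omega>) - (norm (l \<omega>))\<^sup>2 = (norm (l \<omega>))\<^sup>2" by (simp add: power2_norm_eq_inner)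
      finally show ?case by (intro lim_imp_Liminf[symmetric]) auto
    qed
  qed
  also have "\<dots> \<le> liminf (\<lambda>n. \<integral>\<^sup>+\<omega>. ennreal (2 * (u n \<omega> \<bullet> l \<omega>) - (norm (l \<omega>))\<^sup>2) \<partial>M)"
    by (rule nn_integral_liminf) measurable
  also have "\<dots> \<le> liminf (\<lambda>n. C)"
  proof (intro Liminf_mono always_eventually allI)
    fix n
    have "2 * (p \<bullet> q) - (norm q)\<^sup>2 \<le> (norm p)\<^sup>2" for p q :: 'h
      using zero_le_power2[of "norm (p - q)"] by (simp add: power2_norm_eq_inner inner_simps inner_commute)
    then have "(\<integral>\<^sup>+\<omega>. ennreal (2 * (u n \<omega> \<bullet> l \<omega>) - (norm (l \<omega>))\<^sup>2) \<partial>M) \<le> (\<integral>\<^sup>+\<omega>. ennreal ((norm (u n \<omega>))\<^sup>2) \<partial>M)"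
      by (intro nn_integral_mono ennreal_leI)
    then show "(\<integral>\<^sup>+\<omega>. ennreal (2 * (u n \<omega> \<bullet> l \<omega>) - (norm (l \<omega>))\<^sup>2) \<partial>M) \<le> C" using bound[of n] by simp
  qed
  also have "\<dots> = C" by (simp add: Liminf_const)
  finally show ?thesis using \<open>C < \<infinity>\<close> by (auto simp: L2_def integrable_iff_bounded intro: le_less_trans)
qed

text \<open>Fatou's lemma applied to \<open>\<epsilon> |v|\<^sup>2 + |\<zeta>|\<^sup>2 / (4 \<epsilon>) + v \<bullet> \<zeta> \<ge> 0\<close> replaces uniform integrability.\<close>

lemma L2_weak_null_eventually:
  fixes v :: "nat \<Rightarrow> 'w \<Rightarrow> 'h::{real_inner, second_countable_topology}"
  assumes v: "\<And>n. v n \<in> L2 M M" and \<zeta>: "\<zeta> \<in> L2 M M"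
    and lim: "AE \<omega> in M. weakly_tendsto (\<lambda>n. v n \<omega>) 0"
    and bound: "\<And>n. (\<integral>\<omega>. (norm (v n \<omega>))\<^sup>2 \<partial>M) \<le> K" and "0 < \<delta>"
  shows "\<forall>\<^sub>F n in sequentially. - \<delta> < (\<integral>\<omega>. v n \<omega> \<bullet> \<zeta> \<omega> \<partial>M)"
proof -
  have [measurable]: "\<And>n. v n \<in> borel_measurable M" "\<zeta> \<in> borel_measurable M"
    and i: "\<And>n. integrable M (\<lambda>\<omega>. (norm (v n \<omega>))\<^sup>2)" "integrable M (\<lambda>\<omega>. (norm (\<zeta> \<omega>))\<^sup>2)"
    using v \<zeta> by (auto simp: L2_def)
  have K: "0 \<le> K" using bound[of 0] by (rule order_trans[rotated]) simp
  \<comment> \<open>Chosen so that the quadratic term costs at most half of \<open>\<delta>\<close>;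
    adding 1 keeps the denominator positive when \<open>K\<close> is 0.\<close>
  define \<epsilon> where "\<epsilon> = \<delta> / (2 * (K + 1))"
  have \<epsilon>: "0 < \<epsilon>" "\<epsilon> * K \<le> \<delta> / 2" using K \<open>0 < \<delta>\<close> by (auto simp: \<epsilon>_def field_simps)
  define Q where "Q = (\<integral>\<omega>. (norm (\<zeta> \<omega>))\<^sup>2 / (4 * \<epsilon>) \<partial>M)"
  have Q: "0 \<le> Q" unfolding Q_def using \<epsilon> by (intro integral_nonneg_AE) auto
  have pos: "0 \<le> \<epsilon> * (norm p)\<^sup>2 + (norm q)\<^sup>2 / (4 * \<epsilon>) + p \<bullet> q" for p q :: 'h
  proof -
    have "0 \<le> (norm ((2 * \<epsilon>) *\<^sub>R p + q))\<^sup>2 / (4 * \<epsilon>)" using \<epsilon> by simp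
    also have "\<dots> = \<epsilon> * (norm p)\<^sup>2 + (norm q)\<^sup>2 / (4 * \<epsilon>) + p \<bullet> q"
      using \<epsilon> by (simp add: power2_norm_eq_inner inner_simps inner_commute field_simps)
    finally show ?thesis .
  qed
  define I where "I = (\<lambda>n. \<integral>\<omega>. v n \<omega> \<bullet> \<zeta> \<omega> \<partial>M)"
  have "ennreal Q = (\<integral>\<^sup>+\<omega>. ennreal ((norm (\<zeta> \<omega>))\<^sup>2 / (4 * \<epsilon>)) \<partial>M)"
    unfolding Q_def using i \<epsilon> by (intro nn_integral_eq_integral[symmetric]) auto
  also have "\<dots> = (\<integral>\<^sup>+\<omega>. liminf (\<lambda>n. ennreal ((norm (\<zeta> \<omega>))\<^sup>2 / (4 * \<epsilon>) + v n \<omega> \<bullet> \<zeta> \<omega>)) \<partial>M)"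
  proof (rule nn_integral_cong_AE)
    show "AE \<omega> in M. ennreal ((norm (\<zeta> \<omega>))\<^sup>2 / (4 * \<epsilon>)) = liminf (\<lambda>n. ennreal ((norm (\<zeta> \<omega>))\<^sup>2 / (4 * \<epsilon>) + v n \<omega> \<bullet> \<zeta> \<omega>))"
      using lim
    proof eventually_elim
      case (elim \<omega>)
      have "(\<lambda>n. ennreal ((norm (\<zeta> \<omega>))\<^sup>2 / (4 * \<epsilon>) + v n \<omega> \<bullet> \<zeta> \<omega>)) \<longlonglongrightarrow> ennreal ((norm (\<zeta> \<omega>))\<^sup>2 / (4 * \<epsilon>) + 0 \<bullet> \<zeta> \<omega>)"
        using elim by (intro tendsto_ennrealI tendsto_add tendsto_const) (auto simp: weakly_tendsto_def)
      then show ?case by (intro lim_imp_Liminf[symmetric]) auto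
    qed
  qed
  also have "\<dots> \<le> liminf (\<lambda>n. \<integral>\<^sup>+\<omega>. ennreal ((norm (\<zeta> \<omega>))\<^sup>2 / (4 * \<epsilon>) + v n \<omega> \<bullet> \<zeta> \<omega>) \<partial>M)"
    by (rule nn_integral_liminf) measurable
  also have "\<dots> \<le> liminf (\<lambda>n. ennreal (\<delta> / 2 + Q + I n))"
  proof (intro Liminf_mono always_eventually allI)
    fix n
    \<comment> \<open>The quadratic term need not converge pointwise, so it is added only after
      Fatou. Until then \<open>ennreal\<close> truncates the integrand at 0; with it the integrand
      is nonnegative and the integral is a real one.\<close>
    have "(\<integral>\<^sup>+\<omega>. ennreal ((norm (\<zeta> \<omega>))\<^sup>2 / (4 * \<epsilon>) + v n \<omega> \<bullet> \<zeta> \<omega>) \<partial>M)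
      \<le> (\<integral>\<^sup>+\<omega>. ennreal (\<epsilon> * (norm (v n \<omega>))\<^sup>2 + (norm (\<zeta> \<omega>))\<^sup>2 / (4 * \<epsilon>) + v n \<omega> \<bullet> \<zeta> \<omega>) \<partial>M)"
      using \<epsilon> by (intro nn_integral_mono ennreal_leI) simp
    also have "\<dots> = ennreal (\<integral>\<omega>. \<epsilon> * (norm (v n \<omega>))\<^sup>2 + (norm (\<zeta> \<omega>))\<^sup>2 / (4 * \<epsilon>) + v n \<omega> \<bullet> \<zeta> \<omega> \<partial>M)"
      using pos i L2_inner_integrable[OF v \<zeta>] by (intro nn_integral_eq_integral) auto
    also have "(\<integral>\<omega>. \<epsilon> * (norm (v n \<omega>))\<^sup>2 + (norm (\<zeta> \<omega>))\<^sup>2 / (4 * \<epsilon>) + v n \<omega> \<bullet> \<zeta> \<omega> \<partial>M)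
        = \<epsilon> * (\<integral>\<omega>. (norm (v n \<omega>))\<^sup>2 \<partial>M) + Q + I n"
      unfolding Q_def I_def using i L2_inner_integrable[OF v \<zeta>] by (subst Bochner_Integration.integral_add; simp)+
    also have "\<dots> \<le> \<delta> / 2 + Q + I n"
      using \<epsilon> bound[of n] by (intro add_right_mono order_trans[OF mult_left_mono \<epsilon>(2)]) auto
    finally show "(\<integral>\<^sup>+\<omega>. ennreal ((norm (\<zeta> \<omega>))\<^sup>2 / (4 * \<epsilon>) + v n \<omega> \<bullet> \<zeta> \<omega>) \<partial>M) \<le> ennreal (\<delta> / 2 + Q + I n)"
      by (simp add: ennreal_leI)
  qed
  finally have Qle: "ennreal Q \<le> liminf (\<lambda>n. ennreal (\<delta> / 2 + Q + I n))" .
  show ?thesis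
  proof (rule ccontr)
    assume "\<not> ?thesis"
    then have freq: "\<exists>\<^sub>F n in sequentially. I n \<le> - \<delta>" by (simp add: frequently_def not_le I_def)
    show False
    \<comment> \<open>\<open>ennreal\<close> hides negative values, so the liminf is informative
      only if \<open>Q - \<delta> / 2\<close> is nonnegative. Otherwise nonnegativity of the full
      integral already bounds \<open>I n\<close> below by \<open>- \<delta> / 2 - Q\<close>, which
      exceeds \<open>- \<delta>\<close>.\<close>
    proof (cases "\<delta> / 2 \<le> Q")
      case True
      have "ennreal (Q - \<delta> / 2) < ennreal Q" using True \<open>0 < \<delta>\<close> Q by (intro ennreal_lessI) auto
      then have "\<forall>\<^sub>F n in sequentially. ennreal (Q - \<delta> / 2) < ennreal (\<delta> / 2 + Q + I n)"
        using Qle by (intro less_LiminfD) auto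
      then have "\<forall>\<^sub>F n in sequentially. - \<delta> < I n"
        by eventually_elim (use True in \<open>auto simp: ennreal_less_iff\<close>)
      then show False using freq by (simp add: frequently_def not_le)
    next
      case False
      have "0 \<le> \<delta> / 2 + Q + I n" for n
      proof -
        have "0 \<le> (\<integral>\<omega>. \<epsilon> * (norm (v n \<omega>))\<^sup>2 + (norm (\<zeta> \<omega>))\<^sup>2 / (4 * \<epsilon>) + v n \<omega> \<bullet> \<zeta> \<omega> \<partial>M)"
          using pos by (intro integral_nonneg_AE) auto
        also have "\<dots> = \<epsilon> * (\<integral>\<omega>. (norm (v n \<omega>))\<^sup>2 \<partial>M) + Q + I n"
          unfolding Q_def I_def using i L2_inner_integrable[OF v \<zeta>] by (subst Bochner_Integration.integral_add; simp)+
        also have "\<dots> \<le> \<delta> / 2 + Q + I n"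
          using \<epsilon> bound[of n] by (intro add_right_mono order_trans[OF mult_left_mono \<epsilon>(2)]) auto
        finally show ?thesis .
      qed
      then have "- \<delta> < I n" for n using False by (smt (verit) field_sum_of_halves)
      then show False using freq by (simp add: frequently_def not_le)
    qed
  qed
qed

text \<open>The preceding lower bound is one-sided; testing with \<open>\<zeta>\<close> and with its
  negative gives convergence.\<close>

lemma weakly_tendsto_L2I:
  fixes u :: "nat \<Rightarrow> 'w \<Rightarrow> 'h::{real_inner, second_countable_topology}"
  assumes u: "\<And>n. u n \<in> L2 M M" and l: "l \<in> L2 M M"
    and lim: "AE \<omega> in M. weakly_tendsto (\<lambda>n. u n \<omega>) (l \<omega>)"
    and bound: "\<And>n. (\<integral>\<omega>. (norm (u n \<omega> - l \<omega>))\<^sup>2 \<partial>M) \<le> K"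
  shows "weakly_tendsto_L2 M u l"
  unfolding weakly_tendsto_L2_def
proof
  fix \<zeta> :: "'w \<Rightarrow> 'h" assume \<zeta>: "\<zeta> \<in> L2 M M"
  have m\<zeta>: "(\<lambda>\<omega>. - \<zeta> \<omega>) \<in> L2 M M" using \<zeta> by (simp add: L2_def)
  define v where "v = (\<lambda>n \<omega>. u n \<omega> - l \<omega>)"
  have v: "v n \<in> L2 M M" for n unfolding v_def by (rule L2_diff[OF u l])
  have v0: "AE \<omega> in M. weakly_tendsto (\<lambda>n. v n \<omega>) 0"
    using lim
  proof eventually_elim
    case (elim \<omega>)
    then have "(\<lambda>n. u n \<omega> \<bullet> h - l \<omega> \<bullet> h) \<longlonglongrightarrow> 0" for h
      by (simp add: weakly_tendsto_def LIM_zero)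
    then show ?case by (simp add: weakly_tendsto_def v_def inner_diff_left)
  qed
  have b: "(\<integral>\<omega>. (norm (v n \<omega>))\<^sup>2 \<partial>M) \<le> K" for n using bound by (simp add: v_def)
  have I: "(\<integral>\<omega>. v n \<omega> \<bullet> \<zeta> \<omega> \<partial>M) = (\<integral>\<omega>. u n \<omega> \<bullet> \<zeta> \<omega> \<partial>M) - (\<integral>\<omega>. l \<omega> \<bullet> \<zeta> \<omega> \<partial>M)" for n
    unfolding v_def inner_diff_left using L2_inner_integrable[OF u \<zeta>] L2_inner_integrable[OF l \<zeta>] by simp
  show "(\<lambda>n. \<integral>\<omega>. u n \<omega> \<bullet> \<zeta> \<omega> \<partial>M) \<longlonglongrightarrow> (\<integral>\<omega>. l \<omega> \<bullet> \<zeta> \<omega> \<partial>M)"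
  proof (rule LIM_zero_cancel, rule tendstoI)
    fix e :: real assume "0 < e"
    from L2_weak_null_eventually[OF v \<zeta> v0 b this] L2_weak_null_eventually[OF v m\<zeta> v0 b this]
    show "\<forall>\<^sub>F n in sequentially. dist ((\<integral>\<omega>. u n \<omega> \<bullet> \<zeta> \<omega> \<partial>M) - (\<integral>\<omega>. l \<omega> \<bullet> \<zeta> \<omega> \<partial>M)) 0 < e"
      by eventually_elim (auto simp: I dist_real_def)
  qed
qed

section \<open>The stochastic proximal point iteration\<close>

text \<open>The negative part of \<open>X\<close> is at most \<open>R\<close>, so its conditional
  expectation is at most \<open>R\<close>, hence finite, and the difference defining
  \<open>ereal_cond_exp\<close> can be rearranged. The signed quantity becomes a single nonnegative
  conditional expectation.\<close>

lemma (in sigma_finite_subalgebra) ereal_cond_exp_add_real: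
  assumes [measurable]: "X \<in> borel_measurable M" "R \<in> borel_measurable F"
    and R: "\<And>\<omega>. 0 \<le> R \<omega>" and nonneg: "\<And>\<omega>. 0 \<le> X \<omega> + ereal (R \<omega>)"
  shows "AE \<omega> in M. ereal_cond_exp M F X \<omega> + ereal (R \<omega>)
           = enn2ereal (nn_cond_exp M F (\<lambda>\<omega>. e2ennreal (X \<omega> + ereal (R \<omega>))) \<omega>)"
proof -
  let ?E = "nn_cond_exp M F"
  let ?p = "\<lambda>\<omega>. e2ennreal (X \<omega>)" and ?n = "\<lambda>\<omega>. e2ennreal (- X \<omega>)" and ?R = "\<lambda>\<omega>. ennreal (R \<omega>)"
    and ?N = "\<lambda>\<omega>. e2ennreal (X \<omega> + ereal (R \<omega>))"
  have [measurable]: "R \<in> borel_measurable M" using assms(2) by (rule measurable_from_subalg[OF subalg])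
  \<comment> \<open>An identity between sums, without subtraction, so that additivity of
    \<open>nn_cond_exp\<close> applies to both sides.\<close>
  have sum_le: "?p \<omega> + ?R \<omega> = ?N \<omega> + ?n \<omega> \<and> ?n \<omega> \<le> ?R \<omega>" for \<omega>
  proof (cases "X \<omega>")
    case (real a)
    show ?thesis
    proof (cases "0 \<le> a")
      case True
      then show ?thesis using real R[of \<omega>] by (simp add: ennreal_neg)
    next
      case False
      have "0 \<le> a + R \<omega>" using nonneg[of \<omega>] real by simp
      then have "ennreal (a + R \<omega>) + ennreal (- a) = ennreal (R \<omega>)"
        using False by (subst ennreal_plus[symmetric]) auto
      then show ?thesis
        using False real \<open>0 \<le> a + R \<omega>\<close> by (simp add: ennreal_neg ennreal_leI)
    qed
  next
    case PInf
    then show ?thesis by (simp add: e2ennreal_neg)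
  next
    case MInf
    then show ?thesis using nonneg[of \<omega>] by simp
  qed
  then have sum: "?p \<omega> + ?R \<omega> = ?N \<omega> + ?n \<omega>" and le: "?n \<omega> \<le> ?R \<omega>" for \<omega> by blast+
  have "AE \<omega> in M. ?E ?p \<omega> + ?E ?R \<omega> = ?E (\<lambda>\<omega>. ?p \<omega> + ?R \<omega>) \<omega>"
    by (rule nn_cond_exp_sum) auto
  moreover have "AE \<omega> in M. ?E ?N \<omega> + ?E ?n \<omega> = ?E (\<lambda>\<omega>. ?N \<omega> + ?n \<omega>) \<omega>"
    by (rule nn_cond_exp_sum) auto
  moreover have "AE \<omega> in M. ?R \<omega> = ?E ?R \<omega>" by (rule nn_cond_exp_F_meas) auto
  moreover have "AE \<omega> in M. ?E ?n \<omega> \<le> ?E ?R \<omega>" by (rule nn_cond_exp_mono) (auto simp: le)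
  ultimately show ?thesis
  proof eventually_elim
    case (elim \<omega>)
    then have "?E ?p \<omega> + ennreal (R \<omega>) = ?E ?N \<omega> + ?E ?n \<omega>" by (simp add: sum)
    moreover have "?E ?n \<omega> \<le> ennreal (R \<omega>)" using elim by simp
    then obtain b where "?E ?n \<omega> = ennreal b" "0 \<le> b" by (cases "?E ?n \<omega>") (auto simp: top_unique)
    ultimately show ?case
      unfolding ereal_cond_exp_def using R[of \<omega>]
      by (cases "?E ?p \<omega>"; cases "?E ?N \<omega>")
         (auto simp: ennreal_plus[symmetric] enn2ereal_top simp del: ennreal_plus)
  qed
qed

text \<open>Passing from \<open>fy\<close> to \<open>fy - m\<close> costs the additional error term \<open>u (\<gamma> |m|)\<close>, since \<open>m\<close> may be positive.\<close>

lemma approx_prox_shift: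
  fixes E u r :: ennreal and fy :: ereal and \<gamma> m q :: real
  assumes "0 < \<gamma>" "0 \<le> q" "u < top" "ereal m \<le> fy"
    and le: "enn2ereal (E + ennreal (\<gamma> * (m + \<bar>m\<bar>)))
      \<le> (1 + enn2ereal u) * (ereal \<gamma> * fy) + enn2ereal r + ereal (q + \<gamma> * \<bar>m\<bar>)"
  shows "E \<le> (1 + u) * (ennreal \<gamma> * e2ennreal (fy - ereal m)) + u * ennreal (\<gamma> * \<bar>m\<bar>) + r + ennreal q"
proof (cases "fy = \<infinity> \<or> r = top")
  case True
  then show ?thesis using assms(1) by (auto simp: ennreal_mult_top ennreal_mult_eq_top_iff)
next
  case False
  then obtain y s where y: "fy = ereal y" "m \<le> y" and s: "r = ennreal s" "0 \<le> s"
    using assms(4) by (cases fy; cases r) auto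
  obtain t where t: "u = ennreal t" "0 \<le> t" using assms(3) by (cases u) auto
  have "0 \<le> \<gamma> * (m + \<bar>m\<bar>)" using assms(1) by simp
  have "E \<noteq> top" using le y s t by (auto simp: enn2ereal_top one_ereal_def)
  then obtain e where e: "E = ennreal e" "0 \<le> e" by (cases E) auto
  have "e + \<gamma> * (m + \<bar>m\<bar>) \<le> (1 + t) * (\<gamma> * y) + s + (q + \<gamma> * \<bar>m\<bar>)"
    using le \<open>0 \<le> \<gamma> * (m + \<bar>m\<bar>)\<close> y s t e
    by (simp add: ennreal_plus[symmetric] one_ereal_def del: ennreal_plus)
  \<comment> \<open>The identity behind this is \<open>(1 + t) * \<gamma> * y - \<gamma> * m = (1 +
    t) * \<gamma> * (y - m) + t * \<gamma> * m\<close>; its last term is the residue of the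
    shift.\<close>
  then have "e \<le> (1 + t) * (\<gamma> * (y - m)) + t * (\<gamma> * m) + s + q" by (simp add: algebra_simps)
  also have "\<dots> \<le> (1 + t) * (\<gamma> * (y - m)) + t * (\<gamma> * \<bar>m\<bar>) + s + q"
    using t assms(1) by (intro add_right_mono add_left_mono mult_left_mono) auto
  finally have "ennreal e \<le> ennreal ((1 + t) * (\<gamma> * (y - m)) + t * (\<gamma> * \<bar>m\<bar>) + s + q)" by (rule ennreal_leI)
  also have "\<dots> = (1 + u) * (ennreal \<gamma> * e2ennreal (fy - ereal m)) + u * ennreal (\<gamma> * \<bar>m\<bar>) + r + ennreal q"
    using y s t assms by (simp add: ennreal_mult)
  finally show ?thesis using e by simp
qed

text \<open>The polarization identity writes the inner product in the relation as half of the
  squared distances from \<open>p\<close> to \<open>y\<close> and \<open>x\<close>, minus half of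
  that between \<open>y\<close> and \<open>x\<close>. The last one is known to \<open>A\<close> and
  moves to the right-hand side.\<close>

lemma (in prob_space) approx_prox_excess_le:
  fixes f :: "'h::{real_inner, banach, second_countable_topology} \<Rightarrow> ereal"
  assumes sub: "subalgebra M A" and f: "f \<in> Gamma0" and min: "\<And>h. ereal m \<le> f h" and \<gamma>: "0 < \<gamma>"
    and x: "x \<in> L2 M A" and p: "p \<in> L2 M M" and y: "y \<in> L2 M A"
    and prox: "approx_prox M A \<mu> \<rho> (\<lambda>h. ereal \<gamma> * f h) x p"
    and fin: "AE \<omega> in M. nn_cond_exp M A (\<lambda>w. ennreal (\<mu> w)) \<omega> < \<infinity>"
  shows "AE \<omega> in M. nn_cond_exp M A (\<lambda>\<omega>. ennreal ((norm (y \<omega> - p \<omega>))\<^sup>2 / 2 + (norm (x \<omega> - p \<omega>))\<^sup>2 / 2)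
            + ennreal \<gamma> * e2ennreal (f (p \<omega>) - ereal m)) \<omega>
     \<le> (1 + nn_cond_exp M A (\<lambda>w. ennreal (\<mu> w)) \<omega>) * (ennreal \<gamma> * e2ennreal (f (y \<omega>) - ereal m))
       + nn_cond_exp M A (\<lambda>w. ennreal (\<mu> w)) \<omega> * ennreal (\<gamma> * \<bar>m\<bar>)
       + nn_cond_exp M A (\<lambda>w. ennreal (\<rho> w)) \<omega> + ennreal ((norm (y \<omega> - x \<omega>))\<^sup>2 / 2)"
proof -
  interpret sf: sigma_finite_subalgebra M A using sub by (rule sigma_finite_subalgebraI)
  have xA[measurable]: "x \<in> borel_measurable A" and yA[measurable]: "y \<in> borel_measurable A"
    and [measurable]: "p \<in> borel_measurable M"
    using x y p by (auto simp: L2_def)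
  have [measurable]: "x \<in> borel_measurable M" "y \<in> borel_measurable M"
    using measurable_from_subalg[OF sub] xA yA by blast+
  have [measurable]: "f \<in> borel_measurable borel" using f by (rule Gamma0_borel_measurable)
  let ?E = "nn_cond_exp M A"
  define X where "X = (\<lambda>w. ereal ((y w - p w) \<bullet> (x w - p w)) + ereal \<gamma> * f (p w))"
  \<comment> \<open>The squared distance compensates the inner product;
    \<open>\<gamma> * \<bar>m\<bar>\<close> compensates a possibly negative minimum of
    \<open>f\<close>.\<close>
  define R where "R = (\<lambda>w. (norm (y w - x w))\<^sup>2 / 2 + \<gamma> * \<bar>m\<bar>)"
  define N where "N = (\<lambda>w. ennreal ((norm (y w - p w))\<^sup>2 / 2 + (norm (x w - p w))\<^sup>2 / 2)
            + ennreal \<gamma> * e2ennreal (f (p w) - ereal m))"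
  \<comment> \<open>What is left of the constants after splitting off the excess:
    \<open>\<gamma> * m\<close> from \<open>f\<close> and \<open>\<gamma> * \<bar>m\<bar>\<close>
    from \<open>R\<close>. It is nonnegative for either sign of \<open>m\<close>.\<close>
  define c where "c = ennreal (\<gamma> * (m + \<bar>m\<bar>))"
  have [measurable]: "X \<in> borel_measurable M" "R \<in> borel_measurable A" "N \<in> borel_measurable M"
    unfolding X_def R_def N_def by measurable
  have c0: "0 \<le> \<gamma> * (m + \<bar>m\<bar>)" using \<gamma> by simp
  have XR: "X w + ereal (R w) = enn2ereal (N w + c)" for w
  proof -
    have id: "(y w - p w) \<bullet> (x w - p w) + (norm (y w - x w))\<^sup>2 / 2 = (norm (y w - p w))\<^sup>2 / 2 + (norm (x w - p w))\<^sup>2 / 2"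
      by (simp add: power2_norm_eq_inner inner_simps inner_commute field_simps)
    show ?thesis
    proof (cases "f (p w)")
      case (real a)
      then have a: "m \<le> a" using min[of "p w"] by simp
      have a0: "0 \<le> \<gamma> * (a - m)" using a \<gamma> by simp
      have "N w + c = ennreal ((norm (y w - p w))\<^sup>2 / 2 + (norm (x w - p w))\<^sup>2 / 2) + ennreal (\<gamma> * (a - m)) + c"
        unfolding N_def using real a \<gamma> by (simp add: ennreal_mult)
      also have "\<dots> = ennreal ((norm (y w - p w))\<^sup>2 / 2 + (norm (x w - p w))\<^sup>2 / 2 + \<gamma> * (a - m) + \<gamma> * (m + \<bar>m\<bar>))"
        unfolding c_def using a0 c0 by simp
      finally have "N w + c = ennreal ((norm (y w - p w))\<^sup>2 / 2 + (norm (x w - p w))\<^sup>2 / 2 + \<gamma> * (a - m) + \<gamma> * (m + \<bar>m\<bar>))" .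
      then have "enn2ereal (N w + c) = ereal ((norm (y w - p w))\<^sup>2 / 2 + (norm (x w - p w))\<^sup>2 / 2 + \<gamma> * (a - m) + \<gamma> * (m + \<bar>m\<bar>))"
        by (simp only:) (rule enn2ereal_ennreal, use a0 c0 in simp)
      then show ?thesis unfolding X_def R_def using real id by (simp add: algebra_simps)
    next
      case PInf
      then show ?thesis using \<gamma> by (simp add: X_def R_def N_def enn2ereal_top ennreal_mult_top)
    next
      case MInf
      then show ?thesis using min[of "p w"] by simp
    qed
  qed
  have "AE \<omega> in M. ereal_cond_exp M A X \<omega> + ereal (R \<omega>) = enn2ereal (?E (\<lambda>\<omega>. e2ennreal (X \<omega> + ereal (R \<omega>))) \<omega>)"
    by (rule sf.ereal_cond_exp_add_real) (use \<gamma> in \<open>auto simp: XR\<close>, simp add: R_def)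
  then have 1: "AE \<omega> in M. ereal_cond_exp M A X \<omega> + ereal (R \<omega>) = enn2ereal (?E (\<lambda>\<omega>. N \<omega> + c) \<omega>)"
    by (simp add: XR)
  have 2: "AE \<omega> in M. ?E N \<omega> + ?E (\<lambda>_. c) \<omega> = ?E (\<lambda>\<omega>. N \<omega> + c) \<omega>"
    by (rule sf.nn_cond_exp_sum) auto
  have 3: "AE \<omega> in M. c = ?E (\<lambda>_. c) \<omega>" by (rule sf.nn_cond_exp_F_meas) auto
  have 4: "AE \<omega> in M. ereal_cond_exp M A X \<omega>
        \<le> (1 + enn2ereal (?E (\<lambda>w. ennreal (\<mu> w)) \<omega>)) * (ereal \<gamma> * f (y \<omega>)) + enn2ereal (?E (\<lambda>w. ennreal (\<rho> w)) \<omega>)"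
    using prox y unfolding approx_prox_def X_def by blast
  from 1 2 3 4 fin have "AE \<omega> in M. ?E N \<omega>
     \<le> (1 + ?E (\<lambda>w. ennreal (\<mu> w)) \<omega>) * (ennreal \<gamma> * e2ennreal (f (y \<omega>) - ereal m))
       + ?E (\<lambda>w. ennreal (\<mu> w)) \<omega> * ennreal (\<gamma> * \<bar>m\<bar>)
       + ?E (\<lambda>w. ennreal (\<rho> w)) \<omega> + ennreal ((norm (y \<omega> - x \<omega>))\<^sup>2 / 2)"
  proof eventually_elim
    case (elim \<omega>)
    show ?case
    proof (rule approx_prox_shift)
      have "enn2ereal (?E N \<omega> + c) = ereal_cond_exp M A X \<omega> + ereal (R \<omega>)"
        unfolding elim(1) using elim(2,3) by simp
      also have "\<dots> \<le> (1 + enn2ereal (?E (\<lambda>w. ennreal (\<mu> w)) \<omega>)) * (ereal \<gamma> * f (y \<omega>))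
          + enn2ereal (?E (\<lambda>w. ennreal (\<rho> w)) \<omega>) + ereal (R \<omega>)"
        using elim(4) by (rule add_right_mono)
      finally show "enn2ereal (?E N \<omega> + ennreal (\<gamma> * (m + \<bar>m\<bar>)))
        \<le> (1 + enn2ereal (?E (\<lambda>w. ennreal (\<mu> w)) \<omega>)) * (ereal \<gamma> * f (y \<omega>))
          + enn2ereal (?E (\<lambda>w. ennreal (\<rho> w)) \<omega>) + ereal ((norm (y \<omega> - x \<omega>))\<^sup>2 / 2 + \<gamma> * \<bar>m\<bar>)"
        by (simp add: c_def R_def)
      show "?E (\<lambda>w. ennreal (\<mu> w)) \<omega> < top" using elim(5) by simp
    qed (rule \<gamma>, simp, rule min)
  qed
  then show ?thesis by (simp add: N_def)
qed

section \<open>The filtration generated by the iterates\<close>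

lemma space_generated_algebra: "space (generated_algebra M x n) = space M"
  unfolding generated_algebra_def by (rule space_measure_of) auto

lemma sets_generated_algebra:
  "sets (generated_algebra M x n) = sigma_sets (space M) (\<Union>k\<in>{..n}. {x k -` B \<inter> space M | B. B \<in> sets borel})"
  unfolding generated_algebra_def by (rule sets_measure_of) auto

lemma sets_generated_algebra_mono:
  "m \<le> n \<Longrightarrow> sets (generated_algebra M x m) \<subseteq> sets (generated_algebra M x n)"
  unfolding sets_generated_algebra by (rule sigma_sets_mono', rule UN_mono) auto

lemma measurable_generated_algebra:
  fixes x :: "nat \<Rightarrow> 'w \<Rightarrow> 'h::topological_space"
  shows "x n \<in> borel_measurable (generated_algebra M x n)"
proof (rule measurableI)
  fix B assume "B \<in> sets (borel :: 'h measure)"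
  then show "x n -` B \<inter> space (generated_algebra M x n) \<in> sets (generated_algebra M x n)"
    unfolding space_generated_algebra sets_generated_algebra by (intro sigma_sets.Basic UN_I[of n]) auto
qed simp

lemma subalgebra_generated_algebra:
  assumes "\<And>n. x n \<in> borel_measurable M" shows "subalgebra M (generated_algebra M x n)"
  unfolding subalgebra_def space_generated_algebra sets_generated_algebra
  by (rule conjI, rule refl, rule sets.sigma_sets_subset) (auto intro: measurable_sets[OF assms])

lemma suminf_Suc_le: "(\<Sum>n. g (Suc n)) \<le> (\<Sum>n. g n)" for g :: "nat \<Rightarrow> ennreal"
  using suminf_offset[of g 1] by simp

lemma (in sigma_finite_subalgebra) nn_integral_nn_cond_exp:
  assumes "g \<in> borel_measurable M" shows "(\<integral>\<^sup>+\<omega>. nn_cond_exp M F g \<omega> \<partial>M) = (\<integral>\<^sup>+\<omega>. g \<omega> \<partial>M)"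
  using nn_cond_exp_intg[of "\<lambda>_. 1" g] assms by simp

section \<open>Almost supermartingale inequalities for the iterates\<close>

locale stochastic_proximal_point = prob_space M for M :: "'w measure" +
  fixes f :: "'h::{real_inner, banach, second_countable_topology} \<Rightarrow> ereal"
    and \<gamma> :: "nat \<Rightarrow> real"
    and \<mu> \<rho> :: "nat \<Rightarrow> 'w \<Rightarrow> real"
    and x :: "nat \<Rightarrow> 'w \<Rightarrow> 'h"
    and F :: "nat \<Rightarrow> 'w measure"
  assumes f: "f \<in> Gamma0" and Argmin: "Argmin f \<noteq> {}"
    and \<gamma>_pos: "0 < \<gamma> n" and \<gamma>_dec: "decseq \<gamma>" and \<gamma>_div: "\<not> summable \<gamma>"
    and x: "x n \<in> L2 M M"
    and F_def: "F n = generated_algebra M x n"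
    and prox: "approx_prox M (F n) (\<mu> n) (\<rho> n) (\<lambda>h. ereal (\<gamma> n) * f h) (x n) (x (Suc n))"
    and \<mu>_sum: "AE \<omega> in M. (\<Sum>n. nn_cond_exp M (F n) (\<lambda>w. ennreal (\<mu> n w)) \<omega>) < \<infinity>"
    and \<rho>_sum: "AE \<omega> in M.
           (\<Sum>n. ennreal (inverse (\<gamma> n)) * nn_cond_exp M (F n) (\<lambda>w. ennreal (\<rho> n w)) \<omega>) < \<infinity>"
begin

lemma x_measurable [measurable]: "x n \<in> borel_measurable M"
  using x by (simp add: L2_def)

sublocale filtered_prob_space M F
  by unfold_locales
     (auto simp: F_def subalgebra_generated_algebra sets_generated_algebra_mono[THEN subsetD])

lemma x_adapted [measurable]: "x n \<in> borel_measurable (F n)"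
  unfolding F_def by (rule measurable_generated_algebra)

lemma x_L2: "x n \<in> L2 M (F n)"
  using x[of n] by (simp add: L2_def)

definition fmin :: real where "fmin = real_of_ereal (INF h. f h)"

lemma fmin: "(INF h. f h) = ereal fmin" "ereal fmin \<le> f h" "z \<in> Argmin f \<Longrightarrow> f z = ereal fmin"
proof -
  obtain z0 where z0: "z0 \<in> Argmin f" using Argmin by auto
  show 1: "(INF h. f h) = ereal fmin"
    using Gamma0_min_ereal[OF f z0] by (metis fmin_def real_of_ereal.simps(1))
  show "ereal fmin \<le> f h" unfolding 1[symmetric] by (rule INF_lower) simp
  show "f z = ereal fmin" if "z \<in> Argmin f"
    unfolding 1[symmetric] using that by (intro antisym INF_greatest INF_lower) (auto simp: Argmin_def)
qed

definition excess :: "'h \<Rightarrow> ennreal" where "excess h = e2ennreal (f h - ereal fmin)"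

lemma excess_measurable [measurable]: "excess \<in> borel_measurable borel"
proof -
  have [measurable]: "f \<in> borel_measurable borel" using f by (rule Gamma0_borel_measurable)
  show ?thesis unfolding excess_def[abs_def] by measurable
qed

lemma excess_Argmin: "z \<in> Argmin f \<Longrightarrow> excess z = 0"
  by (simp add: excess_def fmin)

lemma enn2ereal_excess: "enn2ereal (excess h) = f h - ereal fmin"
  unfolding excess_def using fmin(2)[of h] by (intro enn2ereal_e2ennreal) (cases "f h"; simp)

abbreviation cexp :: "nat \<Rightarrow> ('w \<Rightarrow> ennreal) \<Rightarrow> 'w \<Rightarrow> ennreal" where
  "cexp n \<equiv> nn_cond_exp M (F n)"

definition mu :: "nat \<Rightarrow> 'w \<Rightarrow> ennreal" where "mu n = cexp n (\<lambda>w. ennreal (\<mu> n w))"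
definition rho :: "nat \<Rightarrow> 'w \<Rightarrow> ennreal" where "rho n = cexp n (\<lambda>w. ennreal (\<rho> n w))"

lemma mu_rho_measurable [measurable]: "mu n \<in> borel_measurable (F n)" "rho n \<in> borel_measurable (F n)"
  unfolding mu_def rho_def by measurable

lemma mu_finite: "AE \<omega> in M. mu n \<omega> < \<infinity>"
  using \<mu>_sum by eventually_elim (auto simp: mu_def dest: ennreal_suminf_lessD)

text \<open>The squared step length is discarded and the conditional expectation split, so that the
  distance and the excess can be exploited separately.\<close>

lemma excess_le:
  assumes y: "y \<in> L2 M (F n)"
  shows "AE \<omega> in M. cexp n (\<lambda>\<omega>. ennreal ((norm (y \<omega> - x (Suc n) \<omega>))\<^sup>2 / 2)) \<omega>
            + ennreal (\<gamma> n) * cexp n (\<lambda>\<omega>. excess (x (Suc n) \<omega>)) \<omega>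
     \<le> (1 + mu n \<omega>) * (ennreal (\<gamma> n) * excess (y \<omega>)) + mu n \<omega> * ennreal (\<gamma> n * \<bar>fmin\<bar>) + rho n \<omega>
       + ennreal ((norm (y \<omega> - x n \<omega>))\<^sup>2 / 2)"
proof -
  interpret sf: sigma_finite_subalgebra M "F n" by (rule sigma_finite_subalgebra_F)
  have "y \<in> borel_measurable (F n)" using y by (simp add: L2_def)
  then have [measurable]: "y \<in> borel_measurable M" by (rule measurable_F_M)
  let ?Y = "\<lambda>\<omega>. ennreal ((norm (y \<omega> - x (Suc n) \<omega>))\<^sup>2 / 2)" and ?a = "\<lambda>\<omega>. excess (x (Suc n) \<omega>)"
  let ?N = "\<lambda>\<omega>. ennreal ((norm (y \<omega> - x (Suc n) \<omega>))\<^sup>2 / 2 + (norm (x n \<omega> - x (Suc n) \<omega>))\<^sup>2 / 2) + ennreal (\<gamma> n) * ?a \<omega>"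
  have 1: "AE \<omega> in M. cexp n ?N \<omega>
     \<le> (1 + mu n \<omega>) * (ennreal (\<gamma> n) * excess (y \<omega>)) + mu n \<omega> * ennreal (\<gamma> n * \<bar>fmin\<bar>) + rho n \<omega>
       + ennreal ((norm (y \<omega> - x n \<omega>))\<^sup>2 / 2)"
    unfolding excess_def mu_def rho_def
    by (rule approx_prox_excess_le[OF subalgebra_F f fmin(2) \<gamma>_pos x_L2 x y prox mu_finite[unfolded mu_def]])
  have 2: "AE \<omega> in M. cexp n (\<lambda>\<omega>. ?Y \<omega> + ennreal (\<gamma> n) * ?a \<omega>) \<omega> \<le> cexp n ?N \<omega>"
    by (rule sf.nn_cond_exp_mono) (auto intro!: add_right_mono ennreal_leI)
  have 3: "AE \<omega> in M. cexp n ?Y \<omega> + cexp n (\<lambda>\<omega>. ennreal (\<gamma> n) * ?a \<omega>) \<omega> = cexp n (\<lambda>\<omega>. ?Y \<omega> + ennreal (\<gamma> n) * ?a \<omega>) \<omega>"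
    by (rule sf.nn_cond_exp_sum) auto
  have 4: "AE \<omega> in M. ennreal (\<gamma> n) * cexp n ?a \<omega> = cexp n (\<lambda>\<omega>. ennreal (\<gamma> n) * ?a \<omega>) \<omega>"
    by (rule sf.nn_cond_exp_prod) auto
  from 1 2 3 4 show ?thesis
  proof eventually_elim
    case (elim \<omega>)
    show ?case unfolding elim(4) elim(3) using elim(2,1) by (rule order_trans)
  qed
qed

lemma fejer:
  assumes z: "z \<in> Argmin f"
  shows "AE \<omega> in M. cexp n (\<lambda>\<omega>. ennreal ((norm (z - x (Suc n) \<omega>))\<^sup>2 / 2)) \<omega>
            + ennreal (\<gamma> n) * cexp n (\<lambda>\<omega>. excess (x (Suc n) \<omega>)) \<omega>
     \<le> ennreal ((norm (z - x n \<omega>))\<^sup>2 / 2) + (mu n \<omega> * ennreal (\<gamma> n * \<bar>fmin\<bar>) + rho n \<omega>)"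
proof -
  have "(\<lambda>_. z) \<in> L2 M (F n)" by (simp add: L2_def)
  from excess_le[OF this] show ?thesis by eventually_elim (simp add: excess_Argmin[OF z] add_ac)
qed

text \<open>At the test point \<open>x n\<close> the distance on the right vanishes and the one on
  the left is dropped. Dividing by \<open>\<gamma> n\<close> brings in the weight
  \<open>inverse (\<gamma> n)\<close> on \<open>rho n\<close>.\<close>

lemma descent:
  "AE \<omega> in M. cexp n (\<lambda>\<omega>. excess (x (Suc n) \<omega>)) \<omega>
     \<le> (1 + mu n \<omega>) * excess (x n \<omega>) + (mu n \<omega> * ennreal \<bar>fmin\<bar> + ennreal (inverse (\<gamma> n)) * rho n \<omega>)"
  using excess_le[OF x_L2[of n]]
proof eventually_elim
  case (elim \<omega>)
  let ?E = "cexp n (\<lambda>\<omega>. excess (x (Suc n) \<omega>)) \<omega>" and ?i = "ennreal (inverse (\<gamma> n))"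
  have i: "?i * ennreal (\<gamma> n) = 1" using \<gamma>_pos[of n] by (simp add: ennreal_mult[symmetric])
  have "ennreal (\<gamma> n) * ?E \<le> (1 + mu n \<omega>) * (ennreal (\<gamma> n) * excess (x n \<omega>)) + mu n \<omega> * (ennreal (\<gamma> n) * ennreal \<bar>fmin\<bar>) + rho n \<omega>"
    using elim \<gamma>_pos[of n] by (auto simp: ennreal_mult intro: order_trans[rotated])
  then have "?i * (ennreal (\<gamma> n) * ?E)
      \<le> ?i * ((1 + mu n \<omega>) * (ennreal (\<gamma> n) * excess (x n \<omega>)) + mu n \<omega> * (ennreal (\<gamma> n) * ennreal \<bar>fmin\<bar>) + rho n \<omega>)"
    by (rule mult_left_mono) simp
  also have "\<dots> = (?i * ennreal (\<gamma> n)) * ((1 + mu n \<omega>) * excess (x n \<omega>) + mu n \<omega> * ennreal \<bar>fmin\<bar>) + ?i * rho n \<omega>"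
    by (simp add: distrib_left mult_ac)
  finally show ?case by (simp add: mult.assoc[symmetric] i add.assoc)
qed

text \<open>Decreasing step sizes are bounded by \<open>\<gamma> 0\<close>, which controls the
  factor of \<open>mu n\<close> and turns the weighted sum of \<open>rho n\<close> into an
  unweighted one.\<close>

lemma mu_rho_sum_finite:
  "AE \<omega> in M. (\<Sum>n. mu n \<omega> * ennreal (\<gamma> n * \<bar>fmin\<bar>) + rho n \<omega>) < \<infinity>"
  using \<mu>_sum \<rho>_sum
proof eventually_elim
  case (elim \<omega>)
  have \<gamma>0: "\<gamma> n \<le> \<gamma> 0" for n using \<gamma>_dec by (simp add: decseq_def)
  have "mu n \<omega> * ennreal (\<gamma> n * \<bar>fmin\<bar>) \<le> mu n \<omega> * ennreal (\<gamma> 0 * \<bar>fmin\<bar>)" for n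
    using \<gamma>0 by (intro mult_left_mono ennreal_leI mult_right_mono) auto
  moreover have "rho n \<omega> \<le> ennreal (\<gamma> 0) * (ennreal (inverse (\<gamma> n)) * rho n \<omega>)" for n
  proof -
    have "rho n \<omega> = ennreal (\<gamma> n) * (ennreal (inverse (\<gamma> n)) * rho n \<omega>)"
      using \<gamma>_pos[of n] by (simp add: mult.assoc[symmetric] ennreal_mult[symmetric])
    also have "\<dots> \<le> ennreal (\<gamma> 0) * (ennreal (inverse (\<gamma> n)) * rho n \<omega>)"
      using \<gamma>0 by (intro mult_right_mono ennreal_leI) auto
    finally show ?thesis .
  qed
  ultimately have "(\<Sum>n. mu n \<omega> * ennreal (\<gamma> n * \<bar>fmin\<bar>) + rho n \<omega>)
     \<le> (\<Sum>n. mu n \<omega> * ennreal (\<gamma> 0 * \<bar>fmin\<bar>) + ennreal (\<gamma> 0) * (ennreal (inverse (\<gamma> n)) * rho n \<omega>))"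
    by (intro suminf_le add_mono) auto
  also have "\<dots> = (\<Sum>n. mu n \<omega>) * ennreal (\<gamma> 0 * \<bar>fmin\<bar>) + ennreal (\<gamma> 0) * (\<Sum>n. ennreal (inverse (\<gamma> n)) * rho n \<omega>)"
    by (simp add: suminf_add[symmetric])
  also have "\<dots> < \<infinity>" using elim by (simp add: ennreal_mult_less_top mu_def rho_def)
  finally show ?case .
qed

text \<open>The excess vanishes at \<open>z\<close>, and with it the multiplicative error, so
  Robbins--Siegmund applies with \<open>\<alpha>\<close> equal to 0 and the excess as the
  gain.\<close>

lemma fejer_convergent:
  assumes z: "z \<in> Argmin f"
  shows "AE \<omega> in M. (\<Sum>n. ennreal (\<gamma> n) * cexp n (\<lambda>\<omega>. excess (x (Suc n) \<omega>)) \<omega>) < \<infinity>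
     \<and> convergent (\<lambda>n. (norm (x n \<omega> - z))\<^sup>2)"
proof -
  have "AE \<omega> in M. (\<Sum>n. ennreal (\<gamma> n) * cexp n (\<lambda>\<omega>. excess (x (Suc n) \<omega>)) \<omega>) < \<infinity>
     \<and> (\<exists>l<\<infinity>. (\<lambda>n. ennreal ((norm (z - x n \<omega>))\<^sup>2 / 2)) \<longlonglongrightarrow> l)"
    by (rule robbins_siegmund[where \<alpha>="\<lambda>_ _. 0" and \<beta>="\<lambda>n \<omega>. mu n \<omega> * ennreal (\<gamma> n * \<bar>fmin\<bar>) + rho n \<omega>"])
       (use fejer[OF z] mu_rho_sum_finite in auto)
  then show ?thesis
  proof eventually_elim
    case (elim \<omega>)
    then obtain l where "l < \<infinity>" "(\<lambda>n. ennreal ((norm (z - x n \<omega>))\<^sup>2 / 2)) \<longlonglongrightarrow> l" by auto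
    then obtain r where "0 \<le> r" "(\<lambda>n. ennreal ((norm (z - x n \<omega>))\<^sup>2 / 2)) \<longlonglongrightarrow> ennreal r" by (cases l) auto
    then have "(\<lambda>n. (norm (z - x n \<omega>))\<^sup>2 / 2) \<longlonglongrightarrow> r" by (intro tendsto_ennrealD[where F=sequentially]) auto
    then have "(\<lambda>n. 2 * ((norm (z - x n \<omega>))\<^sup>2 / 2)) \<longlonglongrightarrow> 2 * r" by (rule tendsto_mult_left)
    then show ?case using elim by (auto simp: convergent_def norm_minus_commute)
  qed
qed

lemma cexp_excess_sum_finite:
  "AE \<omega> in M. (\<Sum>n. ennreal (\<gamma> n) * cexp n (\<lambda>\<omega>. excess (x (Suc n) \<omega>)) \<omega>) < \<infinity>"
proof -
  obtain z where "z \<in> Argmin f" using Argmin by auto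
  from fejer_convergent[OF this] show ?thesis by auto
qed

lemma excess_sum_finite: "AE \<omega> in M. (\<Sum>n. ennreal (\<gamma> n) * excess (x (Suc n) \<omega>)) < \<infinity>"
proof (rule AE_suminf_finite_if_cond_exp)
  have "AE \<omega> in M. ennreal (\<gamma> n) * cexp n (\<lambda>\<omega>. excess (x (Suc n) \<omega>)) \<omega>
      = cexp n (\<lambda>\<omega>. ennreal (\<gamma> n) * excess (x (Suc n) \<omega>)) \<omega>" for n
  proof -
    interpret sf: sigma_finite_subalgebra M "F n" by (rule sigma_finite_subalgebra_F)
    show ?thesis by (rule sf.nn_cond_exp_prod) auto
  qed
  then have "AE \<omega> in M. \<forall>n. ennreal (\<gamma> n) * cexp n (\<lambda>\<omega>. excess (x (Suc n) \<omega>)) \<omega>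
      = cexp n (\<lambda>\<omega>. ennreal (\<gamma> n) * excess (x (Suc n) \<omega>)) \<omega>" by (simp add: AE_all_countable)
  then show "AE \<omega> in M. (\<Sum>n. cexp n (\<lambda>\<omega>. ennreal (\<gamma> n) * excess (x (Suc n) \<omega>)) \<omega>) < \<infinity>"
    using cexp_excess_sum_finite by eventually_elim simp
qed measurable

text \<open>Unit weights and \<open>\<theta>\<close> are both covered. The growth of
  \<open>w\<close> adds \<open>\<gamma> n\<close> times the conditional mean of the next excess to
  the errors, a summable term, so the weighted excess converges; divergence of the ratios then
  forces the limit 0.\<close>

lemma weighted_excess_tendsto_0:
  assumes w: "\<And>n. 0 < w n" "\<And>n. w (Suc n) \<le> w n + \<gamma> (Suc n)"
    and div: "\<not> summable (\<lambda>n. \<gamma> n / w n)"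
    and \<mu>w: "AE \<omega> in M. (\<Sum>n. ennreal (w n) * mu n \<omega>) < \<infinity>"
    and \<rho>w: "AE \<omega> in M. (\<Sum>n. ennreal (inverse (\<gamma> n) * w n) * rho n \<omega>) < \<infinity>"
  shows "AE \<omega> in M. (\<lambda>n. ennreal (w n) * excess (x n \<omega>)) \<longlonglongrightarrow> 0"
proof -
  \<comment> \<open>Time starts at 1: the excess of \<open>x 0\<close> may be infinite with positive
    probability, while that of \<open>x (Suc 0)\<close> is almost surely finite by
    summability.\<close>
  interpret S: filtered_prob_space M "\<lambda>n. F (Suc n)"
    by unfold_locales (simp_all add: subalgebra_F sets_F_mono)
  define c where "c = (\<lambda>n \<omega>. cexp n (\<lambda>\<omega>. excess (x (Suc n) \<omega>)) \<omega>)"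
  define \<beta> where "\<beta> = (\<lambda>n \<omega>. ennreal (w n) * mu n \<omega> * ennreal \<bar>fmin\<bar> + ennreal (inverse (\<gamma> n) * w n) * rho n \<omega>
     + ennreal (\<gamma> n) * c n \<omega>)"
  have [measurable]: "\<beta> n \<in> borel_measurable (F n)" for n unfolding \<beta>_def c_def by measurable
  have "AE \<omega> in M. (\<Sum>n. 0::ennreal) < \<infinity> \<and> (\<exists>l<\<infinity>. (\<lambda>n. ennreal (w (Suc n)) * excess (x (Suc n) \<omega>)) \<longlonglongrightarrow> l)"
  proof (rule S.robbins_siegmund[where \<alpha>="\<lambda>n. mu (Suc n)" and \<beta>="\<lambda>n. \<beta> (Suc n)" and U="\<lambda>_ _. 0"])
    fix n
    interpret sf: sigma_finite_subalgebra M "F (Suc n)" by (rule sigma_finite_subalgebra_F)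
    let ?w = "w (Suc n)" and ?w' = "w (Suc (Suc n))" and ?g = "\<gamma> (Suc n)"
    have "AE \<omega> in M. ennreal ?w' * c (Suc n) \<omega> = cexp (Suc n) (\<lambda>\<omega>. ennreal ?w' * excess (x (Suc (Suc n)) \<omega>)) \<omega>"
      unfolding c_def by (rule sf.nn_cond_exp_prod) auto
    then show "AE \<omega> in M. cexp (Suc n) (\<lambda>\<omega>. ennreal ?w' * excess (x (Suc (Suc n)) \<omega>)) \<omega> + 0
      \<le> (1 + mu (Suc n) \<omega>) * (ennreal ?w * excess (x (Suc n) \<omega>)) + \<beta> (Suc n) \<omega>"
      using descent[of "Suc n"]
    proof eventually_elim
      case (elim \<omega>)
      let ?E = "c (Suc n) \<omega>" and ?m = "mu (Suc n) \<omega>" and ?r = "rho (Suc n) \<omega>" and ?a = "excess (x (Suc n) \<omega>)"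
      \<comment> \<open>Monotonicity replaces the next step size by the current one, which is the
        weight that the Fejer estimate attaches to this conditional mean.\<close>
      have "?w' \<le> ?w + ?g" using w(2)[of "Suc n"] \<gamma>_dec[THEN decseqD, of "Suc n" "Suc (Suc n)"] by simp
      then have "ennreal ?w' \<le> ennreal ?w + ennreal ?g"
        using w(1)[of "Suc n"] \<gamma>_pos[of "Suc n"] by (simp add: ennreal_plus[symmetric] ennreal_leI del: ennreal_plus)
      then have "ennreal ?w' * ?E \<le> (ennreal ?w + ennreal ?g) * ?E" by (rule mult_right_mono) simp
      also have "\<dots> = ennreal ?w * ?E + ennreal ?g * ?E" by (simp add: distrib_right)
      also have "\<dots> \<le> ennreal ?w * ((1 + ?m) * ?a + (?m * ennreal \<bar>fmin\<bar> + ennreal (inverse ?g) * ?r)) + ennreal ?g * ?E"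
        using elim by (intro add_right_mono mult_left_mono) (auto simp: c_def)
      also have "\<dots> = (1 + ?m) * (ennreal ?w * ?a) + \<beta> (Suc n) \<omega>"
        using w(1)[of "Suc n"] \<gamma>_pos[of "Suc n"]
        by (simp add: \<beta>_def ennreal_mult distrib_left mult_ac add_ac)
      finally show ?case using elim(1) by simp
    qed
  next
    show "AE \<omega> in M. (\<Sum>n. mu (Suc n) \<omega>) < \<infinity>"
      using \<mu>_sum by eventually_elim (auto simp: mu_def intro: le_less_trans[OF suminf_Suc_le])
    show "AE \<omega> in M. (\<Sum>n. \<beta> (Suc n) \<omega>) < \<infinity>"
      using \<mu>w \<rho>w cexp_excess_sum_finite
    proof eventually_elim
      case (elim \<omega>)
      have "(\<Sum>n. \<beta> n \<omega>) < \<infinity>"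
        using elim by (simp add: \<beta>_def c_def suminf_add[symmetric] ennreal_mult_less_top)
      then show ?case by (rule le_less_trans[OF suminf_Suc_le])
    qed
    show "AE \<omega> in M. ennreal (w (Suc 0)) * excess (x (Suc 0) \<omega>) < \<infinity>"
      using excess_sum_finite
    proof eventually_elim
      case (elim \<omega>)
      from ennreal_suminf_lessD[OF this, of 0] show ?case
        using \<gamma>_pos[of 0] by (auto simp: ennreal_mult_less_top)
    qed
  qed measurable
  then show ?thesis using excess_sum_finite
  proof eventually_elim
    case (elim \<omega>)
    then obtain l where l: "(\<lambda>n. ennreal (w (Suc n)) * excess (x (Suc n) \<omega>)) \<longlonglongrightarrow> l" by auto
    have "l = 0"
    proof (rule weighted_limit_eq_0[OF _ _ _ _ l])
      show "\<not> summable (\<lambda>n. \<gamma> (Suc n) / w (Suc n))" using div by (subst summable_Suc_iff)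
      have "(\<Sum>n. ennreal (\<gamma> (Suc n)) * excess (x (Suc n) \<omega>)) \<le> (\<Sum>n. ennreal (\<gamma> n) * excess (x (Suc n) \<omega>))"
        using \<gamma>_dec by (intro suminf_le mult_right_mono ennreal_leI) (auto simp: decseq_Suc_iff)
      then show "(\<Sum>n. ennreal (\<gamma> (Suc n)) * excess (x (Suc n) \<omega>)) < \<infinity>" using elim(2) by (rule le_less_trans)
    qed (use \<gamma>_pos w in auto)
    then show ?case using l LIMSEQ_imp_Suc[of "\<lambda>n. ennreal (w n) * excess (x n \<omega>)"] by simp
  qed
qed

section \<open>Weak convergence, almost sure and in \<open>L2\<close>, and the rate\<close>

lemma AE_weakly_tendsto: "AE \<omega> in M. \<exists>p\<in>Argmin f. weakly_tendsto (\<lambda>n. x n \<omega>) p"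
proof -
  obtain D where D: "countable D" "D \<subseteq> Argmin f" "Argmin f \<subseteq> closure D" by (rule separable)
  obtain z0 where z0: "z0 \<in> Argmin f" using Argmin by auto
  have "AE \<omega> in M. \<forall>z\<in>D. convergent (\<lambda>n. (norm (x n \<omega> - z))\<^sup>2)"
    using D(2) by (intro AE_ball_countable'[OF _ D(1)] AE_mp[OF fejer_convergent AE_I2]) auto
  \<comment> \<open>With unit weights the error conditions are the standing assumptions and the
    ratios are the step sizes themselves.\<close>
  moreover have "AE \<omega> in M. (\<lambda>n. ennreal 1 * excess (x n \<omega>)) \<longlonglongrightarrow> 0"
    using \<mu>_sum \<rho>_sum \<gamma>_pos \<gamma>_div
    by (intro weighted_excess_tendsto_0) (auto simp: mu_def rho_def less_imp_le)
  ultimately show ?thesis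
  proof eventually_elim
    case (elim \<omega>)
    have "(\<lambda>n. ereal fmin + enn2ereal (excess (x n \<omega>))) \<longlonglongrightarrow> ereal fmin + enn2ereal 0"
      using elim(2) by (intro tendsto_add_ereal_general tendsto_const) auto
    moreover have "ereal fmin + enn2ereal (excess (x n \<omega>)) = f (x n \<omega>)" for n
      unfolding enn2ereal_excess by (cases "f (x n \<omega>)") auto
    ultimately have "(\<lambda>n. f (x n \<omega>)) \<longlonglongrightarrow> ereal fmin" by (simp add: zero_ennreal.rep_eq)
    then show ?case
    proof (rule weakly_tendsto_minimizer[OF f fmin(3)[OF z0] fmin(2), rotated])
      fix z assume "z \<in> Argmin f"
      then show "convergent (\<lambda>n. (norm (x n \<omega> - z))\<^sup>2)"
        by (rule convergent_norm_diff_dense[OF _ D(3), rotated]) (use elim(1) in blast)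
    qed
  qed
qed

text \<open>The limits are chosen path by path, which gives no measurability. It is recovered from
  the inner products with fixed vectors, which are pointwise limits of measurable functions.\<close>

lemma weak_limit:
  "\<exists>z \<in> borel_measurable M. (\<forall>\<omega>\<in>space M. z \<omega> \<in> Argmin f) \<and> (AE \<omega> in M. weakly_tendsto (\<lambda>n. x n \<omega>) (z \<omega>))"
proof -
  obtain N where N: "\<And>\<omega>. \<omega> \<in> space M - N \<Longrightarrow> \<exists>p\<in>Argmin f. weakly_tendsto (\<lambda>n. x n \<omega>) p" "N \<in> null_sets M"
    by (rule AE_E3[OF AE_weakly_tendsto]) (rule that)
  have [measurable]: "N \<in> sets M" using N(2) by auto
  obtain z0 where z0: "z0 \<in> Argmin f" using Argmin by auto
  obtain p where p: "\<And>\<omega>. \<omega> \<in> space M - N \<Longrightarrow> p \<omega> \<in> Argmin f"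
      "\<And>\<omega>. \<omega> \<in> space M - N \<Longrightarrow> weakly_tendsto (\<lambda>n. x n \<omega>) (p \<omega>)"
    using N(1) by metis
  define z where "z = (\<lambda>\<omega>. if \<omega> \<in> N then z0 else p \<omega>)"
  have "z \<in> borel_measurable M"
  proof (rule borel_measurable_inner_imp)
    fix h
    show "(\<lambda>\<omega>. z \<omega> \<bullet> h) \<in> borel_measurable M"
    proof (rule borel_measurable_LIMSEQ_real)
      \<comment> \<open>The iterates are altered on the null set together with the limit, so that
        convergence holds at every point.\<close>
      show "(\<lambda>n. (if \<omega> \<in> N then z0 else x n \<omega>) \<bullet> h) \<longlonglongrightarrow> z \<omega> \<bullet> h" if "\<omega> \<in> space M" for \<omega>
        using p(2)[of \<omega>] that by (cases "\<omega> \<in> N") (auto simp: z_def weakly_tendsto_def)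
    qed measurable
  qed
  moreover have "z \<omega> \<in> Argmin f" if "\<omega> \<in> space M" for \<omega> using p(1) z0 that by (auto simp: z_def)
  moreover have "AE \<omega> in M. weakly_tendsto (\<lambda>n. x n \<omega>) (z \<omega>)"
    using AE_not_in[OF N(2)] by (rule AE_mp) (rule AE_I2, use p(2) in \<open>auto simp: z_def\<close>)
  ultimately show ?thesis by blast
qed

text \<open>Integrating the Fejer inequality bounds the second moments uniformly, since the means of
  the errors are summable. The almost sure weak limit is then square-integrable and is also the weak
  limit in \<open>L2\<close>.\<close>

lemma weak_limit_L2:
  assumes [measurable]: "\<And>n. \<mu> n \<in> borel_measurable M" "\<And>n. \<rho> n \<in> borel_measurable M"
    and \<mu>: "(\<Sum>n. \<integral>\<^sup>+\<omega>. ennreal (\<mu> n \<omega>) \<partial>M) < \<infinity>" and \<rho>: "(\<Sum>n. \<integral>\<^sup>+\<omega>. ennreal (\<rho> n \<omega>) \<partial>M) < \<infinity>"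
  shows "\<exists>z \<in> L2 M M. (\<forall>\<omega>\<in>space M. z \<omega> \<in> Argmin f) \<and> weakly_tendsto_L2 M x z"
proof -
  obtain z0 where z0: "z0 \<in> Argmin f" using Argmin by auto
  obtain z where z[measurable]: "z \<in> borel_measurable M" and z_Argmin: "\<And>\<omega>. \<omega> \<in> space M \<Longrightarrow> z \<omega> \<in> Argmin f"
    and z_lim: "AE \<omega> in M. weakly_tendsto (\<lambda>n. x n \<omega>) (z \<omega>)"
    using weak_limit by blast
  define d where "d = (\<lambda>n. \<integral>\<^sup>+\<omega>. ennreal ((norm (z0 - x n \<omega>))\<^sup>2 / 2) \<partial>M)"
  define s where "s = (\<lambda>n. (\<integral>\<^sup>+\<omega>. ennreal (\<mu> n \<omega>) \<partial>M) * ennreal (\<gamma> 0 * \<bar>fmin\<bar>) + (\<integral>\<^sup>+\<omega>. ennreal (\<rho> n \<omega>) \<partial>M))"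
  have step: "d (Suc n) \<le> d n + s n" for n
  proof -
    interpret sf: sigma_finite_subalgebra M "F n" by (rule sigma_finite_subalgebra_F)
    have [measurable]: "mu n \<in> borel_measurable M" "rho n \<in> borel_measurable M" unfolding mu_def rho_def by measurable
    have "d (Suc n) = (\<integral>\<^sup>+\<omega>. cexp n (\<lambda>\<omega>. ennreal ((norm (z0 - x (Suc n) \<omega>))\<^sup>2 / 2)) \<omega> \<partial>M)"
      unfolding d_def by (rule sf.nn_integral_nn_cond_exp[symmetric]) measurable
    also have "\<dots> \<le> (\<integral>\<^sup>+\<omega>. ennreal ((norm (z0 - x n \<omega>))\<^sup>2 / 2) + (mu n \<omega> * ennreal (\<gamma> 0 * \<bar>fmin\<bar>) + rho n \<omega>) \<partial>M)"
    proof (rule nn_integral_mono_AE)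
      have "ennreal (\<gamma> n * \<bar>fmin\<bar>) \<le> ennreal (\<gamma> 0 * \<bar>fmin\<bar>)"
        using \<gamma>_dec by (intro ennreal_leI mult_right_mono) (auto simp: decseq_def)
      then have le: "mu n \<omega> * ennreal (\<gamma> n * \<bar>fmin\<bar>) \<le> mu n \<omega> * ennreal (\<gamma> 0 * \<bar>fmin\<bar>)" for \<omega>
        by (rule mult_left_mono) simp
      show "AE \<omega> in M. cexp n (\<lambda>\<omega>. ennreal ((norm (z0 - x (Suc n) \<omega>))\<^sup>2 / 2)) \<omega>
         \<le> ennreal ((norm (z0 - x n \<omega>))\<^sup>2 / 2) + (mu n \<omega> * ennreal (\<gamma> 0 * \<bar>fmin\<bar>) + rho n \<omega>)"
        using fejer[OF z0, of n]
      proof eventually_elim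
        case (elim \<omega>)
        have "cexp n (\<lambda>\<omega>. ennreal ((norm (z0 - x (Suc n) \<omega>))\<^sup>2 / 2)) \<omega>
          \<le> ennreal ((norm (z0 - x n \<omega>))\<^sup>2 / 2) + (mu n \<omega> * ennreal (\<gamma> n * \<bar>fmin\<bar>) + rho n \<omega>)"
          using elim by (rule order_trans[rotated]) simp
        also have "\<dots> \<le> ennreal ((norm (z0 - x n \<omega>))\<^sup>2 / 2) + (mu n \<omega> * ennreal (\<gamma> 0 * \<bar>fmin\<bar>) + rho n \<omega>)"
          by (intro add_left_mono add_right_mono le)
        finally show ?case .
      qed
    qed
    also have "\<dots> = d n + ((\<integral>\<^sup>+\<omega>. mu n \<omega> \<partial>M) * ennreal (\<gamma> 0 * \<bar>fmin\<bar>) + (\<integral>\<^sup>+\<omega>. rho n \<omega> \<partial>M))"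
      unfolding d_def by (simp add: nn_integral_add nn_integral_multc)
    also have "\<dots> = d n + s n"
      unfolding s_def mu_def rho_def by (simp add: sf.nn_integral_nn_cond_exp)
    finally show ?thesis .
  qed
  have "d n \<le> d 0 + (\<Sum>k<n. s k)" for n
    by (induction n) (auto intro: order_trans[OF step] simp: add.assoc[symmetric] intro!: add_right_mono)
  then have d_le: "d n \<le> d 0 + (\<Sum>k. s k)" for n
    by (rule order_trans) (intro add_left_mono sum_le_suminf, auto)
  have "(\<Sum>k. s k) < \<infinity>" using \<mu> \<rho> by (simp add: s_def suminf_add[symmetric] ennreal_mult_less_top)
  moreover have "d 0 < \<infinity>"
  proof -
    have "(\<lambda>_. z0) \<in> L2 M M" by (simp add: L2_def)
    from L2_diff[OF this x[of 0]] have "integrable M (\<lambda>\<omega>. (norm (z0 - x 0 \<omega>))\<^sup>2 / 2)" by (simp add: L2_def)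
    then show ?thesis by (simp add: d_def integrable_iff_bounded)
  qed
  ultimately have dfin: "d 0 + (\<Sum>k. s k) < \<infinity>" by simp
  \<comment> \<open>From the squared norm of \<open>q\<close> being at most twice that of
    \<open>z0 - q\<close> plus twice that of \<open>z0\<close>; the factor 4 appears because
    \<open>d n\<close> integrates half of the squared distance.\<close>
  define C where "C = 4 * (d 0 + (\<Sum>k. s k)) + ennreal (2 * (norm z0)\<^sup>2)"
  have C: "C < \<infinity>" using dfin by (simp add: C_def ennreal_mult_less_top)
  have x_bound: "(\<integral>\<^sup>+\<omega>. ennreal ((norm (x n \<omega>))\<^sup>2) \<partial>M) \<le> C" for n
  proof -
    have "(norm q)\<^sup>2 \<le> 4 * ((norm (z0 - q))\<^sup>2 / 2) + 2 * (norm z0)\<^sup>2" for q :: 'h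
    proof -
      have "4 * ((norm (z0 - q))\<^sup>2 / 2) + 2 * (norm z0)\<^sup>2 - (norm q)\<^sup>2 = (norm (2 *\<^sub>R z0 - q))\<^sup>2"
        by (simp add: power2_norm_eq_inner inner_simps inner_commute field_simps)
      then show ?thesis using zero_le_power2[of "norm (2 *\<^sub>R z0 - q)"] by linarith
    qed
    then have "(\<integral>\<^sup>+\<omega>. ennreal ((norm (x n \<omega>))\<^sup>2) \<partial>M)
       \<le> (\<integral>\<^sup>+\<omega>. ennreal (4 * ((norm (z0 - x n \<omega>))\<^sup>2 / 2) + 2 * (norm z0)\<^sup>2) \<partial>M)"
      by (intro nn_integral_mono ennreal_leI)
    also have "\<dots> = (\<integral>\<^sup>+\<omega>. 4 * ennreal ((norm (z0 - x n \<omega>))\<^sup>2 / 2) + ennreal (2 * (norm z0)\<^sup>2) \<partial>M)"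
      by (intro nn_integral_cong) (subst ennreal_plus, simp, simp, subst numeral_mult_ennreal, simp, rule refl)
    also have "\<dots> = 4 * d n + ennreal (2 * (norm z0)\<^sup>2)"
      unfolding d_def by (simp add: nn_integral_add nn_integral_cmult emeasure_space_1)
    also have "\<dots> \<le> C" unfolding C_def by (intro add_right_mono mult_left_mono d_le) auto
    finally show ?thesis .
  qed
  have zL2: "z \<in> L2 M M"
    by (rule weakly_tendsto_limit_L2[OF _ z z_lim x_bound C]) measurable
  have "(\<integral>\<omega>. (norm (x n \<omega> - z \<omega>))\<^sup>2 \<partial>M) \<le> 2 * enn2real C + 2 * (\<integral>\<omega>. (norm (z \<omega>))\<^sup>2 \<partial>M)" for n
  proof -
    have i: "integrable M (\<lambda>\<omega>. (norm (x n \<omega>))\<^sup>2)" "integrable M (\<lambda>\<omega>. (norm (z \<omega>))\<^sup>2)"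
      "integrable M (\<lambda>\<omega>. (norm (x n \<omega> - z \<omega>))\<^sup>2)"
      using x[of n] zL2 L2_diff[OF x[of n] zL2] by (auto simp: L2_def)
    have "(\<integral>\<omega>. (norm (x n \<omega> - z \<omega>))\<^sup>2 \<partial>M) \<le> (\<integral>\<omega>. 2 * (norm (x n \<omega>))\<^sup>2 + 2 * (norm (z \<omega>))\<^sup>2 \<partial>M)"
      using i by (intro integral_mono norm_diff_squared_le) auto
    also have "\<dots> = 2 * (\<integral>\<omega>. (norm (x n \<omega>))\<^sup>2 \<partial>M) + 2 * (\<integral>\<omega>. (norm (z \<omega>))\<^sup>2 \<partial>M)" using i by simp
    also have "(\<integral>\<omega>. (norm (x n \<omega>))\<^sup>2 \<partial>M) \<le> enn2real C"
      using enn2real_mono[OF x_bound[of n]] C nn_integral_eq_integral[OF i(1)] by simp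
    finally show ?thesis by simp
  qed
  then have "weakly_tendsto_L2 M x z" by (rule weakly_tendsto_L2I[OF x zL2 z_lim])
  then show ?thesis using zL2 z_Argmin by blast
qed

text \<open>The weights \<open>\<theta>\<close> meet the growth condition with equality, and
  Abel--Dini supplies the divergence of \<open>\<gamma> n / \<theta> n\<close>.\<close>

lemma excess_rate:
  assumes \<theta>: "\<And>n. \<theta> n = (\<Sum>k\<le>n. \<gamma> k)"
    and \<mu>: "AE \<omega> in M. (\<Sum>n. ennreal (\<theta> n) * nn_cond_exp M (F n) (\<lambda>w. ennreal (\<mu> n w)) \<omega>) < \<infinity>"
    and \<rho>: "AE \<omega> in M. (\<Sum>n. ennreal (inverse (\<gamma> n) * \<theta> n) * nn_cond_exp M (F n) (\<lambda>w. ennreal (\<rho> n w)) \<omega>) < \<infinity>"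
  shows "AE \<omega> in M. (\<lambda>n. ereal (\<theta> n) * (f (x n \<omega>) - (INF h. f h))) \<longlonglongrightarrow> 0"
proof -
  have \<theta>_pos: "0 < \<theta> n" for n unfolding \<theta> using \<gamma>_pos by (intro sum_pos) auto
  have "\<not> summable (\<lambda>n. \<gamma> n / \<theta> n)"
    unfolding \<theta> by (rule not_summable_divide_partial_sums[OF \<gamma>_pos \<gamma>_div])
  then have "AE \<omega> in M. (\<lambda>n. ennreal (\<theta> n) * excess (x n \<omega>)) \<longlonglongrightarrow> 0"
    using \<mu> \<rho> by (intro weighted_excess_tendsto_0 \<theta>_pos) (auto simp: mu_def rho_def \<theta>)
  then show ?thesis
  proof eventually_elim
    case (elim \<omega>)
    have "(\<lambda>n. enn2ereal (ennreal (\<theta> n) * excess (x n \<omega>))) \<longlonglongrightarrow> enn2ereal 0"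
      using elim by (rule tendsto_enn2erealI)
    moreover have "enn2ereal (ennreal (\<theta> n) * excess (x n \<omega>)) = ereal (\<theta> n) * (f (x n \<omega>) - (INF h. f h))" for n
      using \<theta>_pos[of n] by (simp add: times_ennreal.rep_eq enn2ereal_excess fmin(1))
    ultimately show ?case by (simp add: zero_ennreal.rep_eq)
  qed
qed

end

theorem theorem3p5:
  fixes M :: "'w measure"
    and f :: "'h::{real_inner, banach, second_countable_topology} \<Rightarrow> ereal"
    and \<gamma> :: "nat \<Rightarrow> real"
    and \<mu> \<rho> :: "nat \<Rightarrow> 'w \<Rightarrow> real"
    and x0 :: "'w \<Rightarrow> 'h"
    and x :: "nat \<Rightarrow> 'w \<Rightarrow> 'h"
    and F :: "nat \<Rightarrow> 'w measure"
    and \<theta> :: "nat \<Rightarrow> real"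
  assumes "prob_space M" and "complete_measure M"
    and "f \<in> Gamma0" and "Argmin f \<noteq> {}"
    and "\<And>n. 0 < \<gamma> n" and "decseq \<gamma>" and "(\<Sum>n. ennreal (\<gamma> n)) = \<infinity>"
    and "\<And>n. \<mu> n \<in> borel_measurable M" and "\<And>n \<omega>. \<omega> \<in> space M \<Longrightarrow> 0 \<le> \<mu> n \<omega>"
    and "\<And>n. \<rho> n \<in> borel_measurable M" and "\<And>n \<omega>. \<omega> \<in> space M \<Longrightarrow> 0 \<le> \<rho> n \<omega>"
    and "x0 \<in> L2 M M" and "x 0 = x0" and "\<And>n. x n \<in> L2 M M"
    and "\<And>n. F n = generated_algebra M x n"
    and "\<And>n. approx_prox M (F n) (\<mu> n) (\<rho> n) (\<lambda>h. ereal (\<gamma> n) * f h) (x n) (x (Suc n))"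
    and "AE \<omega> in M. (\<Sum>n. nn_cond_exp M (F n) (\<lambda>w. ennreal (\<mu> n w)) \<omega>) < \<infinity>"
    and "AE \<omega> in M.
           (\<Sum>n. ennreal (inverse (\<gamma> n)) * nn_cond_exp M (F n) (\<lambda>w. ennreal (\<rho> n w)) \<omega>) < \<infinity>"
    and "\<And>n. \<theta> n = (\<Sum>k\<le>n. \<gamma> k)"
  shows "(\<exists>z \<in> borel_measurable M. (\<forall>\<omega>\<in>space M. z \<omega> \<in> Argmin f) \<and>
            (AE \<omega> in M. weakly_tendsto (\<lambda>n. x n \<omega>) (z \<omega>)))
       \<and> ((\<Sum>n. \<integral>\<^sup>+\<omega>. ennreal (\<mu> n \<omega>) \<partial>M) < \<infinity> \<and>
          (\<Sum>n. \<integral>\<^sup>+\<omega>. ennreal (\<rho> n \<omega>) \<partial>M) < \<infinity> \<longrightarrow>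
            (\<exists>z \<in> L2 M M. (\<forall>\<omega>\<in>space M. z \<omega> \<in> Argmin f) \<and> weakly_tendsto_L2 M x z))
       \<and> ((AE \<omega> in M.
            (\<Sum>n. ennreal (\<theta> n) * nn_cond_exp M (F n) (\<lambda>w. ennreal (\<mu> n w)) \<omega>) < \<infinity>) \<and>
          (AE \<omega> in M.
            (\<Sum>n. ennreal (inverse (\<gamma> n) * \<theta> n)
                   * nn_cond_exp M (F n) (\<lambda>w. ennreal (\<rho> n w)) \<omega>) < \<infinity>) \<longrightarrow>
            (AE \<omega> in M. (\<lambda>n. ereal (\<theta> n) * (f (x n \<omega>) - (INF h. f h))) \<longlonglongrightarrow> 0))"
proof -
  interpret prob_space M by (rule assms(1))
  have \<gamma>_div: "\<not> summable \<gamma>"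
    using assms(7) ennreal_suminf_neq_top[of \<gamma>] assms(5) by (auto intro: less_imp_le)
  interpret stochastic_proximal_point M f \<gamma> \<mu> \<rho> x F
    by unfold_locales (use assms \<gamma>_div in blast)+
  show ?thesis
    using weak_limit weak_limit_L2[OF assms(8,10)] excess_rate[OF assms(19)] by blast
qed

end
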